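(* Let $\{\mathbf p_n\}_{n=0}^\infty$ be an arbitrary sequence where $\mathbf p_n\in\mathrm{Sym}(W^{\mathrm{gr}})^{r_n}$ is a column vector of length $r_n$, and $\mathbf p_0=1$. Then the following are equivalent. (1) There exists a quasi-definite linear functional $\mathcal L$ on $\mathrm{Sym}(W^{\mathrm{gr}})$ under which $\{\mathbf p_n\}_{n=0}^\infty$ is a block orthogonal basis of $\mathrm{Sym}(W^{\mathrm{gr}})$. (2) For $n\in\mathbb N_0$, $m\in[n]$, $i\in[N_m]$ and $-m\le k\le m$, there exist matrices $M^k_{n,m,i}\in\mathrm{Mat}(r_{n-m},r_{n-m+k})$ such that (a) $w_{m,i}\,\mathbf p_{n-m}=\sum_{k=-m}^{m}M^k_{n,m,i}\,\mathbf p_{n-m+k}$ for all such $n,m,i$; and (b) the matrices $A_{n,m,i}:=M^m_{n,m,i}\in\mathrm{Mat}(r_{n-m},r_n)$ and $C_{n,m,i}:=M^{-m}_{n+m,m,i}\in\mathrm{Mat}(r_n,r_{n-m})$ satisfy, for every $n\in\mathbb N$, $m\in[n]$, $i\in[N_m]$, $$\mathrm{rank}(A_{n,m,i})=\mathrm{rank}(C_{n,m,i})=r_{n-m}\quad\text{and}\quad \mathrm{rank}(A_n)=\mathrm{rank}(C_n^{\intercal})=r_n,$$ where $A_n$ (resp. $C_n^{\intercal}$) is the matrix with $r_n$ columns obtained by stacking vertically all $A_{n,m,i}$ (resp. all $C_{n,m,i}^{\intercal}$), $m\in[n]$, $i\in[N_m]$.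
   Context: $W=\bigoplus_{m\ge1}W^m$ is a graded real vector space with every $W^m$ finite-dimensional, $N_m=\dim W^m$; $W^{\mathrm{gr}}=\bigoplus_m (W^m)^*$ is the graded dual, and $w_{m,1},\dots,w_{m,N_m}$ is a fixed basis of $(W^m)^*$. $\mathrm{Sym}(W^{\mathrm{gr}})$ is the symmetric algebra, i.e. the commutative real polynomial algebra in the indeterminates $w_{m,i}$. The total degree of a monomial $\prod w_{m,i}^{\alpha_{m,i}}$ is $\sum m\,\alpha_{m,i}$. $r_n$ is the number of monomials of total degree $n$ and $\mathbf w_n$ the column vector of these monomials. $[n]=\{1,\dots,n\}$. $\mathrm{Mat}(a,b)$ denotes real $a\times b$ matrices. Objects with negative degree index are absent ($r_j=0$ and $\mathbf p_j=0$ for $j<0$). A linear functional $\mathcal L:\mathrm{Sym}(W^{\mathrm{gr}})\to\mathbb R$ is quasi-definite if there is a basis of $\mathrm{Sym}(W^{\mathrm{gr}})$ such that for basis elements $P,Q$: $\mathcal L(PQ)=0$ if $P\ne Q$ and $\mathcal L(P^2)\neq0$. Write $(P,Q)=\mathcal L(PQ)$; for column vectors $\mathbf p,\mathbf q$ of polynomials, $(\mathbf p,\mathbf q^{\intercal})$ is the matrix of entrywise values. A sequence $\{\mathbf p_n\}_{n\ge0}$, with $\mathbf p_n$ a column vector of length $r_n$ whose entries have total degree at most $n$, is block orthogonal (under $\mathcal L$) if $(\mathbf w_m,\mathbf p_n^{\intercal})=0$ for all $m<n$ and $(\mathbf w_n,\mathbf p_n^{\intercal})$ is invertible. *)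

theory Defs
  imports
    "HOL-Analysis.Finite_Function_Topology"
    "Jordan_Normal_Form.DL_Rank"
begin

text \<open>
  The graded space \<open>W\<close> enters only through the dimensions \<open>N m = dim W^m\<close> (\<open>m \<ge> 1\<close>; some or all of
  them may be zero) and the fixed bases of the duals. The basis element \<open>w_{m,i}\<close> is the
  indeterminate with index \<open>(m, i)\<close>. Exponents are finitely supported functions, and polynomials
  are finitely supported functions from exponents to reals with the convolution product of
  \<^theory>\<open>HOL-Library.Poly_Mapping\<close>. As \<open>N\<close> is a parameter, \<open>Sym(W^gr)\<close> is a subset of the
  type of polynomials in all indeterminates \<open>(m, i)\<close>.
\<close>

type_synonym exponent = "(nat \<times> nat) \<Rightarrow>\<^sub>0 nat"
type_synonym sympoly = "exponent \<Rightarrow>\<^sub>0 real"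

definition indets :: "(nat \<Rightarrow> nat) \<Rightarrow> (nat \<times> nat) set" where
  "indets N = {(m, i). 1 \<le> m \<and> 1 \<le> i \<and> i \<le> N m}"

definition indet :: "nat \<Rightarrow> nat \<Rightarrow> sympoly" where
  "indet m i = Poly_Mapping.single (Poly_Mapping.single (m, i) 1) 1"

definition Sym :: "(nat \<Rightarrow> nat) \<Rightarrow> sympoly set" where
  "Sym N = {P. \<forall>\<alpha>\<in>Poly_Mapping.keys P. Poly_Mapping.keys \<alpha> \<subseteq> indets N}"

definition tdeg :: "exponent \<Rightarrow> nat" where
  "tdeg \<alpha> = (\<Sum>(m, i)\<in>Poly_Mapping.keys \<alpha>. m * Poly_Mapping.lookup \<alpha> (m, i))"

definition exponents :: "(nat \<Rightarrow> nat) \<Rightarrow> nat \<Rightarrow> exponent set" where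
  "exponents N n = {\<alpha>. Poly_Mapping.keys \<alpha> \<subseteq> indets N \<and> tdeg \<alpha> = n}"

definition r :: "(nat \<Rightarrow> nat) \<Rightarrow> nat \<Rightarrow> nat" where
  "r N n = card (exponents N n)"

lemma finite_exponents: "finite (exponents N n)"
proof -
  let ?K = "(SIGMA m:{1..n}. {1..N m})"
  let ?F = "{f. \<forall>x. (x \<in> ?K \<longrightarrow> f x \<in> {..n}) \<and> (x \<notin> ?K \<longrightarrow> f x = (0::nat))}"
  have "Poly_Mapping.lookup \<alpha> \<in> ?F" if \<alpha>: "\<alpha> \<in> exponents N n" for \<alpha>
  proof -
    have le: "m * Poly_Mapping.lookup \<alpha> (m, i) \<le> n" for m i
    proof (cases "(m, i) \<in> Poly_Mapping.keys \<alpha>")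
      case True
      have "(case (m, i) of (m, i) \<Rightarrow> m * Poly_Mapping.lookup \<alpha> (m, i)) \<le> tdeg \<alpha>"
        unfolding tdeg_def using True by (intro member_le_sum) auto
      then show ?thesis using \<alpha> by (simp add: exponents_def)
    qed (simp add: in_keys_iff)
    have bound: "Poly_Mapping.lookup \<alpha> (m, i) \<le> n \<and> ((m, i) \<notin> ?K \<longrightarrow> Poly_Mapping.lookup \<alpha> (m, i) = 0)" for m i
    proof (cases "(m, i) \<in> Poly_Mapping.keys \<alpha>")
      case True
      then have "(m, i) \<in> indets N" "Poly_Mapping.lookup \<alpha> (m, i) \<ge> 1"
        using \<alpha> by (auto simp: exponents_def in_keys_iff Suc_le_eq)
      then have "m \<ge> 1" "i \<ge> 1" "i \<le> N m" by (auto simp: indets_def)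
      moreover have "m \<le> n"
        using le[of m i] mult_le_mono2[OF \<open>Poly_Mapping.lookup \<alpha> (m, i) \<ge> 1\<close>, of m]
        by (metis le_trans mult.right_neutral)
      moreover have "Poly_Mapping.lookup \<alpha> (m, i) \<le> n"
        using le[of m i] mult_le_mono1[OF \<open>m \<ge> 1\<close>, of "Poly_Mapping.lookup \<alpha> (m, i)"]
        by (metis le_trans mult_1)
      ultimately show ?thesis by simp
    qed (simp add: in_keys_iff)
    have "Poly_Mapping.lookup \<alpha> x \<le> n \<and> (x \<notin> ?K \<longrightarrow> Poly_Mapping.lookup \<alpha> x = 0)" for x
      using bound[of "fst x" "snd x"] unfolding prod.collapse .
    then show ?thesis unfolding mem_Collect_eq atMost_iff by blast
  qed
  then have "Poly_Mapping.lookup ` exponents N n \<subseteq> ?F" by (rule image_subsetI)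
  moreover have "finite ?F" by (rule finite_set_of_finite_funs[OF _ finite_atMost]) (intro finite_SigmaI finite_atLeastAtMost)
  ultimately have "finite (Poly_Mapping.lookup ` exponents N n)" by (rule finite_subset)
  then show ?thesis by (rule finite_imageD) (simp add: inj_on_def lookup_inject)
qed

text \<open>
  The order in which the monomials of total degree \<open>n\<close> are listed in the column vector
  \<open>w n\<close> is arbitrary.
\<close>

definition monomial_vectors :: "(nat \<Rightarrow> nat) \<Rightarrow> (nat \<Rightarrow> sympoly vec) \<Rightarrow> bool" where
  "monomial_vectors N w \<longleftrightarrow>
     (\<forall>n. w n \<in> carrier_vec (r N n) \<and>
          bij_betw (vec_index (w n)) {..<r N n} ((\<lambda>\<alpha>. Poly_Mapping.single \<alpha> 1) ` exponents N n))"

definition linear_functional_on :: "sympoly set \<Rightarrow> (sympoly \<Rightarrow> real) \<Rightarrow> bool" where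
  "linear_functional_on V L \<longleftrightarrow>
     (\<forall>P\<in>V. \<forall>Q\<in>V. L (P + Q) = L P + L Q) \<and> (\<forall>c. \<forall>P\<in>V. L (c *\<^sub>R P) = c * L P)"

definition basis_of :: "sympoly set \<Rightarrow> sympoly set \<Rightarrow> bool" where
  "basis_of V B \<longleftrightarrow> Real_Vector_Spaces.independent B \<and> Real_Vector_Spaces.span B = V"

definition quasi_definite :: "(nat \<Rightarrow> nat) \<Rightarrow> (sympoly \<Rightarrow> real) \<Rightarrow> bool" where
  "quasi_definite N L \<longleftrightarrow>
     (\<exists>B. basis_of (Sym N) B \<and>
          (\<forall>P\<in>B. \<forall>Q\<in>B. P \<noteq> Q \<longrightarrow> L (P * Q) = 0) \<and> (\<forall>P\<in>B. L (P ^ 2) \<noteq> 0))"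

definition gram :: "(sympoly \<Rightarrow> real) \<Rightarrow> sympoly vec \<Rightarrow> sympoly vec \<Rightarrow> real mat" where
  "gram L p q = mat (dim_vec p) (dim_vec q) (\<lambda>(a, b). L (p $ a * q $ b))"

definition poly_vec :: "(nat \<Rightarrow> nat) \<Rightarrow> nat \<Rightarrow> sympoly vec set" where
  "poly_vec N d = {p \<in> carrier_vec d. \<forall>a<d. p $ a \<in> Sym N}"

definition block_orthogonal ::
  "(nat \<Rightarrow> nat) \<Rightarrow> (nat \<Rightarrow> sympoly vec) \<Rightarrow> (sympoly \<Rightarrow> real) \<Rightarrow> (nat \<Rightarrow> sympoly vec) \<Rightarrow> bool" where
  "block_orthogonal N w L p \<longleftrightarrow>
     (\<forall>n. p n \<in> poly_vec N (r N n) \<and>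
          (\<forall>a<r N n. \<forall>\<alpha>\<in>Poly_Mapping.keys (p n $ a). tdeg \<alpha> \<le> n) \<and>
          (\<forall>m<n. gram L (w m) (p n) = 0\<^sub>m (r N m) (r N n)) \<and>
          invertible_mat (gram L (w n) (p n)))"

text \<open>The entries of all the vectors \<open>p n\<close>, as an indexed family, form a basis of \<open>Sym N\<close>.\<close>

definition entries_basis :: "(nat \<Rightarrow> nat) \<Rightarrow> (nat \<Rightarrow> sympoly vec) \<Rightarrow> bool" where
  "entries_basis N p \<longleftrightarrow>
     (let J = (SIGMA n:UNIV. {..<dim_vec (p n)})
      in inj_on (\<lambda>(n, a). p n $ a) J \<and> basis_of (Sym N) ((\<lambda>(n, a). p n $ a) ` J))"

text \<open>Objects with negative degree index are absent: \<open>r_j = 0\<close> and \<open>p_j\<close> is the empty vector.\<close>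

definition r_int :: "(nat \<Rightarrow> nat) \<Rightarrow> int \<Rightarrow> nat" where
  "r_int N j = (if j < 0 then 0 else r N (nat j))"

definition p_int :: "(nat \<Rightarrow> sympoly vec) \<Rightarrow> int \<Rightarrow> sympoly vec" where
  "p_int p j = (if j < 0 then vNil else p (nat j))"

definition mat_poly_vec :: "real mat \<Rightarrow> sympoly vec \<Rightarrow> sympoly vec" where
  "mat_poly_vec A p = vec (dim_row A) (\<lambda>a. \<Sum>b<dim_vec p. A $$ (a, b) *\<^sub>R p $ b)"

text \<open>The parameter of \<^const>\<open>vec_space.rank\<close> is the dimension of the space containing the columns.\<close>

definition mrank :: "real mat \<Rightarrow> nat" where
  "mrank A = vec_space.rank (dim_row A) A"

text \<open>Vertical stack of the blocks \<open>B m i\<close>, each having \<open>c\<close> columns, over \<open>m \<in> [n]\<close>, \<open>i \<in> [N m]\<close>.\<close>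

definition stack :: "(nat \<Rightarrow> nat) \<Rightarrow> nat \<Rightarrow> nat \<Rightarrow> (nat \<Rightarrow> nat \<Rightarrow> real mat) \<Rightarrow> real mat" where
  "stack N c n B =
     mat_of_rows c (concat (map (\<lambda>m. concat (map (\<lambda>i. rows (B m i)) [1..<Suc (N m)])) [1..<Suc n]))"

end

theory Submission
  imports Defs
begin

text \<open>
  Write \<open>p_n = G_n w_n + \<dots>\<close> with terms of lower degree omitted, let \<open>H_n = (w_n, p_n\<^sup>T)\<close>, and let
  \<open>S\<close> be the matrix of multiplication by \<open>w_{m,i}\<close> from the monomials of degree \<open>n - m\<close> to those
  of degree \<open>n\<close>, so that \<open>w_{m,i} w_{n-m} = S w_n\<close>. Comparing top degrees in the recurrence, and
  pairing the recurrence with \<open>w_{n-m}\<close>, gives the identities on which everything rests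
  (\<open>sum_recurrence_top\<close> and \<open>pairing_recurrence\<close>):
  \<open>A_{n,m,i} G_n = G_{n-m} S\<close> and \<open>H_{n-m} C_{n,m,i}\<^sup>T = S H_n\<close>.
  The rows of \<open>S\<close> are distinct unit vectors, and the stack of the matrices \<open>S\<close> for all \<open>m\<close> and \<open>i\<close>
  has trivial kernel, because every monomial of positive degree contains an indeterminate. All
  rank conditions are treated as triviality of left or right kernels.

  From (1) to (2): block orthogonality makes the blocks \<open>(w_m, p_n\<^sup>T)\<close> triangular with invertible
  diagonal. By induction each \<open>G_n\<close> is invertible (\<open>lead_of_pairing\<close>), so polynomials expand in the
  family, and the expansion of \<open>w_{m,i} p_{n-m}\<close> begins at degree \<open>n - 2m\<close> (\<open>recurrence_exists\<close>).
  The rank conditions are then read off from the two identities.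

  From (2) to (1): a coefficient vector of \<open>p_n\<close> at an exponent of degree greater than \<open>n\<close> lies in
  the kernel of \<open>A_n\<close>, which bounds the degrees (\<open>deg_bound_of_recurrence\<close>). The first identity shows
  inductively that \<open>G_n\<close> is invertible, so that the entries form a basis (\<open>family_basis\<close>) and a
  functional with \<open>L 1 = 1\<close> and \<open>L p_n = 0\<close> for \<open>n \<ge> 1\<close> exists. Moving indeterminates from
  monomials to \<open>p_n\<close> proves orthogonality (\<open>orth_of_recurrence\<close>), and the second identity together
  with the rank of \<open>C_n\<^sup>T\<close> shows inductively that \<open>H_n\<close> is invertible. Finally, each block carries a
  nondegenerate symmetric form and can be diagonalized (\<open>quasi_definite_L\<close>).
\<close>

section \<open>Kernels and ranks of real matrices\<close>

text \<open>
  A square coefficient array is nondegenerate when the only solution of the homogeneous linear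
  system that it defines is trivial.
\<close>

definition nondeg :: "nat \<Rightarrow> (nat \<Rightarrow> nat \<Rightarrow> real) \<Rightarrow> bool" where
  "nondeg n f \<longleftrightarrow> (\<forall>x. (\<forall>a<n. (\<Sum>b<n. f a b * x b) = 0) \<longrightarrow> (\<forall>b<n. x b = 0))"

lemma nondegD:
  "nondeg n f \<Longrightarrow> (\<And>a. a < n \<Longrightarrow> (\<Sum>b<n. f a b * x b) = 0) \<Longrightarrow> b < n \<Longrightarrow> x b = 0"
  unfolding nondeg_def by blast

lemma nondeg_cong:
  assumes "\<And>a b. a < n \<Longrightarrow> b < n \<Longrightarrow> f a b = g a b"
  shows "nondeg n f \<longleftrightarrow> nondeg n g"
proof -
  have "(\<Sum>b<n. f a b * x b) = (\<Sum>b<n. g a b * x b)" if "a < n" for a x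
    using assms that by (intro sum.cong) auto
  then have "(\<forall>a<n. (\<Sum>b<n. f a b * x b) = 0) \<longleftrightarrow> (\<forall>a<n. (\<Sum>b<n. g a b * x b) = 0)" for x
    by auto
  then show ?thesis unfolding nondeg_def by blast
qed

lemma mult_mat_vec_index:
  fixes A :: "real mat"
  assumes "A \<in> carrier_mat nr nc" "v \<in> carrier_vec nc" "a < nr"
  shows "(A *\<^sub>v v) $ a = (\<Sum>b<nc. A $$ (a, b) * v $ b)"
  using assms by (auto simp: scalar_prod_def atLeast0LessThan intro!: sum.cong)

text \<open>Triviality of the kernel, in terms of vectors and in terms of coefficient functions.\<close>

lemma kernel_trivial_iff:
  fixes A :: "real mat"
  assumes A: "A \<in> carrier_mat nr nc"
  shows "(\<forall>v\<in>carrier_vec nc. A *\<^sub>v v = 0\<^sub>v nr \<longrightarrow> v = 0\<^sub>v nc) \<longleftrightarrow>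
         (\<forall>x. (\<forall>a<nr. (\<Sum>b<nc. A $$ (a, b) * x b) = 0) \<longrightarrow> (\<forall>b<nc. x b = 0))"
    (is "?L \<longleftrightarrow> ?R")
proof
  assume L: ?L
  show ?R
  proof (intro allI impI)
    fix x b assume x: "\<forall>a<nr. (\<Sum>b<nc. A $$ (a, b) * x b) = 0" and b: "b < nc"
    have "A *\<^sub>v vec nc x = 0\<^sub>v nr"
      using A x by (intro eq_vecI) (auto simp: mult_mat_vec_index[OF A] simp del: index_mult_mat_vec)
    then have "vec nc x = 0\<^sub>v nc" using L by auto
    then have "vec nc x $ b = 0\<^sub>v nc $ b" by simp
    then show "x b = 0" using b by simp
  qed
next
  assume R: ?R
  show ?L
  proof (intro ballI impI)
    fix v assume v: "v \<in> carrier_vec nc" and "A *\<^sub>v v = 0\<^sub>v nr"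
    then have "\<forall>a<nr. (\<Sum>b<nc. A $$ (a, b) * v $ b) = 0"
      by (metis mult_mat_vec_index[OF A v] index_zero_vec(1))
    then have "\<forall>b<nc. v $ b = 0" using R by blast
    then show "v = 0\<^sub>v nc" using v by (intro eq_vecI) auto
  qed
qed

text \<open>Full column rank, for a matrix of any shape, means that the kernel is trivial.\<close>

lemma mrank_eq_cols_iff:
  assumes A: "A \<in> carrier_mat nr nc"
  shows "mrank A = nc \<longleftrightarrow>
         (\<forall>x. (\<forall>a<nr. (\<Sum>b<nc. A $$ (a, b) * x b) = 0) \<longrightarrow> (\<forall>b<nc. x b = 0))"
proof -
  interpret vec_space "TYPE(real)" nr .
  have mr: "mrank A = rank A" using A by (simp add: mrank_def)
  show ?thesis
  proof (cases "distinct (cols A)")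
    case True
    have "rank A = nc \<longleftrightarrow> lin_indpt (set (cols A))"
      using full_rank_lin_indpt[OF A _ True] lin_indpt_full_rank[OF A True] by blast
    also have "\<dots> \<longleftrightarrow> (\<forall>v\<in>carrier_vec nc. A *\<^sub>v v = 0\<^sub>v nr \<longrightarrow> v = 0\<^sub>v nc)"
      using lin_depI[OF A _ _ _ True] lin_depE[OF A _ True] by metis
    finally show ?thesis unfolding mr kernel_trivial_iff[OF A] .
  next
    case False
    then obtain i j where ij: "i < nc" "j < nc" "i \<noteq> j" "col A i = col A j"
      using A by (auto simp: distinct_conv_nth)
    define x :: "nat \<Rightarrow> real" where "x b = (if b = i then 1 else if b = j then -1 else 0)" for b
    \<comment> \<open>Two equal columns give a nonzero kernel vector.\<close>
    have "(\<Sum>b<nc. A $$ (a, b) * x b) = 0" if "a < nr" for a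
    proof -
      have "(\<Sum>b<nc. A $$ (a, b) * x b) = (\<Sum>b\<in>{i, j}. A $$ (a, b) * x b)"
        using ij by (intro sum.mono_neutral_right) (auto simp: x_def)
      also have "\<dots> = A $$ (a, i) - A $$ (a, j)" using ij by (simp add: x_def)
      also have "\<dots> = col A i $ a - col A j $ a" using A ij(1,2) that by simp
      also have "\<dots> = 0" using ij(4) by simp
      finally show ?thesis .
    qed
    moreover have "x i \<noteq> 0" by (simp add: x_def)
    ultimately have "\<not> (\<forall>x. (\<forall>a<nr. (\<Sum>b<nc. A $$ (a, b) * x b) = 0) \<longrightarrow> (\<forall>b<nc. x b = 0))"
      using ij by blast
    moreover have "rank A \<noteq> nc"
    proof -
      obtain S where S: "maximal S (\<lambda>T. T \<subseteq> set (cols A) \<and> lin_indpt T)"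
        using maximal_exists[of "(\<lambda>T. T \<subseteq> set (cols A) \<and> lin_indpt T)" "card (set (cols A))" "{}"]
        by (meson List.finite_set card_mono empty_iff empty_subsetI finite_lin_indpt2 rev_finite_subset)
      then have "rank A \<le> card (set (cols A))"
        by (simp add: rank_card_indpt[OF A S] card_mono maximal_def)
      moreover have "card (set (cols A)) < nc"
        using False A card_length[of "cols A"] card_distinct[of "cols A"] by fastforce
      ultimately show ?thesis by simp
    qed
    ultimately show ?thesis using mr by simp
  qed
qed

lemma det_nonzero_iff_nondeg:
  fixes A :: "real mat"
  assumes A: "A \<in> carrier_mat n n"
  shows "det A \<noteq> 0 \<longleftrightarrow> nondeg n (\<lambda>a b. A $$ (a, b))"
  unfolding nondeg_def using kernel_trivial_iff[OF A] det_0_iff_vec_prod_zero_field[OF A] by blast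

lemma nondeg_iff_det: "nondeg n f \<longleftrightarrow> det (mat n n (\<lambda>(a, b). f a b)) \<noteq> 0"
  unfolding det_nonzero_iff_nondeg[OF mat_carrier] by (rule nondeg_cong) simp

lemma nondeg_transpose: "nondeg n (\<lambda>a b. f b a) \<longleftrightarrow> nondeg n f"
proof -
  have "(mat n n (\<lambda>(a, b). f b a)) = transpose_mat (mat n n (\<lambda>(a, b). f a b))"
    by (intro eq_matI) auto
  then show ?thesis
    unfolding nondeg_iff_det by (simp add: det_transpose[OF mat_carrier])
qed

lemma invertible_mat_iff_nondeg:
  fixes A :: "real mat"
  assumes A: "A \<in> carrier_mat n n"
  shows "invertible_mat A \<longleftrightarrow> nondeg n (\<lambda>a b. A $$ (a, b))"
proof
  assume "invertible_mat A"
  then obtain B where AB: "A * B = 1\<^sub>m n" and BA: "B * A = 1\<^sub>m (dim_row B)"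
    using A by (auto simp: invertible_mat_def inverts_mat_def)
  have "dim_col B = n" using AB by (metis index_mult_mat(3) index_one_mat(3))
  moreover have "dim_row B = n" using BA A by (metis index_mult_mat(3) index_one_mat(3) carrier_matD(2))
  ultimately have "B \<in> carrier_mat n n" by auto
  then have "det A * det B = 1" using AB A det_mult[of A n B] by simp
  then have "det A \<noteq> 0" by auto
  then show "nondeg n (\<lambda>a b. A $$ (a, b))" using det_nonzero_iff_nondeg[OF A] by simp
next
  assume "nondeg n (\<lambda>a b. A $$ (a, b))"
  then have "det A \<noteq> 0" using det_nonzero_iff_nondeg[OF A] by simp
  from det_non_zero_imp_unit[OF A this, of "()"] obtain B where
    "B \<in> carrier_mat n n" "B * A = 1\<^sub>m n" "A * B = 1\<^sub>m n"
    by (auto simp: Units_def ring_mat_def)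
  then show "invertible_mat A"
    using A by (auto simp: invertible_mat_def inverts_mat_def intro!: exI[of _ B])
qed

lemma nondeg_solvable:
  assumes "nondeg n f"
  obtains x where "\<And>a. a < n \<Longrightarrow> (\<Sum>b<n. f a b * x b) = y a"
proof -
  let ?A = "mat n n (\<lambda>(a, b). f a b)"
  have A: "?A \<in> carrier_mat n n" by simp
  have "det ?A \<noteq> 0" using assms nondeg_iff_det by blast
  from det_non_zero_imp_unit[OF A this, of "()"] obtain B where
    B: "B \<in> carrier_mat n n" and AB: "?A * B = 1\<^sub>m n"
    by (auto simp: Units_def ring_mat_def)
  let ?x = "B *\<^sub>v vec n y"
  have x: "?x \<in> carrier_vec n" using B by simp
  have "?A *\<^sub>v ?x = vec n y"
    using assoc_mult_mat_vec[OF A B, of "vec n y"] AB by simp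
  then have "(\<Sum>b<n. f a b * ?x $ b) = y a" if "a < n" for a
    using mult_mat_vec_index[OF A x that] that by simp
  then show thesis by (rule that)
qed

text \<open>
  If the rows of \<open>A\<close> are linearly independent then \<open>A A\<^sup>T\<close> is invertible, because
  \<open>x\<^sup>T A A\<^sup>T x\<close> is the squared length of \<open>A\<^sup>T x\<close>; hence \<open>A\<close> is surjective.
\<close>

lemma mrank_eq_rowsI:
  assumes A: "A \<in> carrier_mat nr nc"
    and left: "\<And>x. (\<And>b. b < nc \<Longrightarrow> (\<Sum>a<nr. x a * A $$ (a, b)) = 0) \<Longrightarrow> \<forall>a<nr. x a = 0"
  shows "mrank A = nr"
proof -
  interpret vec_space "TYPE(real)" nr .
  define f where "f a a' = (\<Sum>b<nc. A $$ (a, b) * A $$ (a', b))" for a a'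
  have nd: "nondeg nr f"
    unfolding nondeg_def
  proof (intro allI impI)
    fix x a assume x: "\<forall>a<nr. (\<Sum>a'<nr. f a a' * x a') = 0" and a: "a < nr"
    define s where "s b = (\<Sum>a<nr. x a * A $$ (a, b))" for b
    have "(\<Sum>b<nc. (s b)\<^sup>2) = (\<Sum>b<nc. \<Sum>a<nr. \<Sum>a'<nr. x a * A $$ (a, b) * (x a' * A $$ (a', b)))"
      by (simp add: s_def power2_eq_square sum_product)
    also have "\<dots> = (\<Sum>a<nr. \<Sum>a'<nr. \<Sum>b<nc. x a * A $$ (a, b) * (x a' * A $$ (a', b)))"
      by (subst sum.swap, rule sum.cong[OF refl], rule sum.swap)
    also have "\<dots> = (\<Sum>a<nr. x a * (\<Sum>a'<nr. f a a' * x a'))"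
      by (simp add: f_def sum_distrib_left sum_distrib_right mult_ac)
    also have "\<dots> = 0" using x by simp
    finally have "(\<Sum>b<nc. (s b)\<^sup>2) = 0" .
    then have "\<forall>b<nc. s b = 0" by (subst (asm) sum_nonneg_eq_0_iff) auto
    then have "\<forall>a<nr. x a = 0" unfolding s_def by (intro left) blast
    then show "x a = 0" using a by blast
  qed
  have surj: "\<exists>v\<in>carrier_vec nc. A *\<^sub>v v = y" if y: "y \<in> carrier_vec nr" for y
  proof -
    obtain x where x: "\<And>a. a < nr \<Longrightarrow> (\<Sum>a'<nr. f a a' * x a') = y $ a"
      using nondeg_solvable[OF nd, of "\<lambda>a. y $ a"] by blast
    let ?v = "vec nc (\<lambda>b. \<Sum>a'<nr. A $$ (a', b) * x a')"
    have v: "?v \<in> carrier_vec nc" by simp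
    have "A *\<^sub>v ?v = y"
    proof (rule eq_vecI)
      fix a assume "a < dim_vec y"
      then have a: "a < nr" using y by simp
      have "(A *\<^sub>v ?v) $ a = (\<Sum>b<nc. A $$ (a, b) * (\<Sum>a'<nr. A $$ (a', b) * x a'))"
        by (subst mult_mat_vec_index[OF A v a]) simp
      also have "\<dots> = (\<Sum>b<nc. \<Sum>a'<nr. A $$ (a, b) * A $$ (a', b) * x a')"
        by (simp add: sum_distrib_left mult_ac)
      also have "\<dots> = (\<Sum>a'<nr. f a a' * x a')"
        by (subst sum.swap) (simp add: f_def sum_distrib_right)
      finally show "(A *\<^sub>v ?v) $ a = y $ a" using x[OF a] by simp
    qed (use A y in auto)
    then show ?thesis using v by blast
  qed
  have "span (set (cols A)) = carrier_vec nr"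
    using col_space_eq[OF A] surj A by (auto simp: col_space_def)
  then have "span_vs (set (cols A)) = V"
    by (simp add: module_vec_def)
  then have "rank A = nr" using dim_is_n by (simp add: rank_def)
  then show ?thesis using A by (simp add: mrank_def)
qed

lemma set_rows_stack:
  "set (concat (map (\<lambda>m. concat (map (\<lambda>i. rows (B m i)) [1..<Suc (N m)])) [1..<Suc n])) =
     (\<Union>m\<in>{1..n}. \<Union>i\<in>{1..N m}. set (rows (B m i)))"
  by (simp add: image_image atLeastLessThanSuc_atLeastAtMost del: upt_Suc)

text \<open>The kernel of a vertical stack is the intersection of the kernels of its blocks.\<close>

lemma mrank_stack_iff:
  assumes B: "\<And>m i. m \<in> {1..n} \<Longrightarrow> i \<in> {1..N m} \<Longrightarrow> B m i \<in> carrier_mat (d m) c"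
  shows "mrank (stack N c n B) = c \<longleftrightarrow>
         (\<forall>x. (\<forall>m\<in>{1..n}. \<forall>i\<in>{1..N m}. \<forall>a<d m. (\<Sum>b<c. B m i $$ (a, b) * x b) = 0)
               \<longrightarrow> (\<forall>b<c. x b = 0))"
proof -
  define rs where
    "rs = concat (map (\<lambda>m. concat (map (\<lambda>i. rows (B m i)) [1..<Suc (N m)])) [1..<Suc n])"
  have st: "stack N c n B = mat_of_rows c rs" by (simp add: stack_def rs_def)
  have car: "stack N c n B \<in> carrier_mat (length rs) c" by (simp add: st)
  have "(\<forall>a<length rs. (\<Sum>b<c. stack N c n B $$ (a, b) * x b) = 0) \<longleftrightarrow>
        (\<forall>m\<in>{1..n}. \<forall>i\<in>{1..N m}. \<forall>a<d m. (\<Sum>b<c. B m i $$ (a, b) * x b) = 0)" for x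
  proof -
    have "(\<forall>a<length rs. (\<Sum>b<c. stack N c n B $$ (a, b) * x b) = 0) \<longleftrightarrow>
          (\<forall>a<length rs. (\<Sum>b<c. (rs ! a) $ b * x b) = 0)"
      by (simp add: st mat_of_rows_index)
    also have "\<dots> \<longleftrightarrow> (\<forall>v\<in>set rs. (\<Sum>b<c. v $ b * x b) = 0)"
      by (simp add: all_set_conv_all_nth)
    also have "\<dots> \<longleftrightarrow> (\<forall>m\<in>{1..n}. \<forall>i\<in>{1..N m}. \<forall>v\<in>set (rows (B m i)). (\<Sum>b<c. v $ b * x b) = 0)"
      unfolding rs_def set_rows_stack by blast
    also have "\<dots> \<longleftrightarrow> (\<forall>m\<in>{1..n}. \<forall>i\<in>{1..N m}. \<forall>a<d m. (\<Sum>b<c. B m i $$ (a, b) * x b) = 0)"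
    proof (intro ball_cong refl)
      fix m i assume "m \<in> {1..n}" "i \<in> {1..N m}"
      then have c: "B m i \<in> carrier_mat (d m) c" by (rule B)
      then show "(\<forall>v\<in>set (rows (B m i)). (\<Sum>b<c. v $ b * x b) = 0) \<longleftrightarrow>
                 (\<forall>a<d m. (\<Sum>b<c. B m i $$ (a, b) * x b) = 0)"
        by (auto simp: all_set_conv_all_nth)
    qed
    finally show ?thesis .
  qed
  then show ?thesis unfolding mrank_eq_cols_iff[OF car] by simp
qed

section \<open>Total degree and the degree filtration\<close>

lemma lookup_scaleR [simp]:
  "Poly_Mapping.lookup (c *\<^sub>R P) \<alpha> = c * Poly_Mapping.lookup (P :: 'a \<Rightarrow>\<^sub>0 real) \<alpha>"
proof -
  have "finite {\<alpha>. c *\<^sub>R Poly_Mapping.lookup P \<alpha> \<noteq> 0}"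
    by (rule finite_subset[OF _ finite_lookup[of P]]) auto
  then show ?thesis by (simp add: scaleR_poly_mapping_def)
qed

lemma scaleR_eq_mult: "c *\<^sub>R (P :: sympoly) = Poly_Mapping.single 0 c * P"
  by (rule poly_mapping_eqI)
    (simp add: mult_map_scale_conv_mult[symmetric] Poly_Mapping.map.rep_eq when_def)

lemma sympoly_scaleR_mult [simp]: "(c *\<^sub>R P) * Q = c *\<^sub>R (P * (Q :: sympoly))"
  by (simp add: scaleR_eq_mult mult.assoc)

lemma sympoly_mult_scaleR [simp]: "P * (c *\<^sub>R Q) = c *\<^sub>R (P * (Q :: sympoly))"
  by (simp add: scaleR_eq_mult mult.left_commute)

lemma lookup_single_mult:
  "Poly_Mapping.lookup (Poly_Mapping.single \<gamma> 1 * P) \<delta> =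
     (\<Sum>\<beta>\<in>Poly_Mapping.keys P. Poly_Mapping.lookup P \<beta> when \<gamma> + \<beta> = \<delta>)"
  for P :: sympoly
proof -
  have "P = (\<Sum>\<beta>\<in>Poly_Mapping.keys P. Poly_Mapping.single \<beta> (Poly_Mapping.lookup P \<beta>))"
    by (rule poly_mapping_eqI)
      (simp add: lookup_sum lookup_single when_def in_keys_iff sum.delta')
  then have "Poly_Mapping.single \<gamma> 1 * P =
      (\<Sum>\<beta>\<in>Poly_Mapping.keys P. Poly_Mapping.single (\<gamma> + \<beta>) (Poly_Mapping.lookup P \<beta>))"
    by (metis (no_types, lifting) mult_single mult_1 sum.cong sum_distrib_left)
  then show ?thesis by (simp add: lookup_sum lookup_single)
qed

lemma lookup_single_mult_shift [simp]:
  "Poly_Mapping.lookup (Poly_Mapping.single \<gamma> 1 * P) (\<gamma> + \<beta>) = Poly_Mapping.lookup P \<beta>"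
  for P :: sympoly
  by (simp add: lookup_single_mult when_def in_keys_iff sum.delta)

lemma keys_single_mult:
  "Poly_Mapping.keys (Poly_Mapping.single \<gamma> 1 * P) = (+) \<gamma> ` Poly_Mapping.keys P"
  for P :: sympoly
proof -
  have "\<delta> \<in> (+) \<gamma> ` Poly_Mapping.keys P"
    if nz: "Poly_Mapping.lookup (Poly_Mapping.single \<gamma> 1 * P) \<delta> \<noteq> 0" for \<delta>
  proof -
    obtain \<beta> where "\<beta> \<in> Poly_Mapping.keys P" "(Poly_Mapping.lookup P \<beta> when \<gamma> + \<beta> = \<delta>) \<noteq> 0"
      using sum.not_neutral_contains_not_neutral[OF nz[unfolded lookup_single_mult]] by blast
    then show ?thesis by (auto simp: when_def split: if_splits)
  qed
  then show ?thesis by (auto simp: in_keys_iff)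
qed

lemma tdeg_sum:
  assumes "finite K" "Poly_Mapping.keys \<alpha> \<subseteq> K"
  shows "tdeg \<alpha> = (\<Sum>x\<in>K. fst x * Poly_Mapping.lookup \<alpha> x)"
proof -
  have "tdeg \<alpha> = (\<Sum>x\<in>Poly_Mapping.keys \<alpha>. fst x * Poly_Mapping.lookup \<alpha> x)"
    unfolding tdeg_def by (intro sum.cong) auto
  also have "\<dots> = (\<Sum>x\<in>K. fst x * Poly_Mapping.lookup \<alpha> x)"
    using assms by (intro sum.mono_neutral_left) (auto simp: in_keys_iff)
  finally show ?thesis .
qed

lemma tdeg_add: "tdeg (\<alpha> + \<beta>) = tdeg \<alpha> + tdeg \<beta>"
proof -
  let ?K = "Poly_Mapping.keys \<alpha> \<union> Poly_Mapping.keys \<beta>"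
  have "Poly_Mapping.keys (\<alpha> + \<beta>) \<subseteq> ?K" by (rule keys_add)
  then show ?thesis
    using tdeg_sum[of ?K \<alpha>] tdeg_sum[of ?K \<beta>] tdeg_sum[of ?K "\<alpha> + \<beta>"]
    by (simp add: lookup_add sum.distrib distrib_left)
qed

lemma keys_add_nat:
  "Poly_Mapping.keys (\<alpha> + \<beta>) = Poly_Mapping.keys \<alpha> \<union> Poly_Mapping.keys \<beta>" for \<alpha> \<beta> :: exponent
  by (auto simp: in_keys_iff lookup_add)

lemma tdeg_single [simp]: "tdeg (Poly_Mapping.single (m, i) k) = m * k"
  by (simp add: tdeg_def)

lemma exponents_add:
  "\<alpha> \<in> exponents N m \<Longrightarrow> \<beta> \<in> exponents N n \<Longrightarrow> \<alpha> + \<beta> \<in> exponents N (m + n)"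
  by (auto simp: exponents_def tdeg_add keys_add_nat)

lemma single_in_exponents:
  "1 \<le> m \<Longrightarrow> i \<in> {1..N m} \<Longrightarrow> Poly_Mapping.single (m, i) 1 \<in> exponents N m"
  by (auto simp: exponents_def indets_def)

lemma exponents_0: "exponents N 0 = {0}"
proof
  show "exponents N 0 \<subseteq> {0}"
  proof
    fix \<alpha> assume \<alpha>: "\<alpha> \<in> exponents N 0"
    have "fst x * Poly_Mapping.lookup \<alpha> x = 0" if "x \<in> Poly_Mapping.keys \<alpha>" for x
      using \<alpha> tdeg_sum[OF finite_keys order_refl, of \<alpha>] that by (simp add: exponents_def)
    moreover have "fst x \<ge> 1" if "x \<in> Poly_Mapping.keys \<alpha>" for x
      using \<alpha> that by (auto simp: exponents_def indets_def)
    ultimately have "x \<notin> Poly_Mapping.keys \<alpha>" for x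
      by (metis in_keys_iff mult_is_0 not_one_le_zero)
    then have "Poly_Mapping.keys \<alpha> = {}" by blast
    then show "\<alpha> \<in> {0}" by simp
  qed
qed (auto simp: exponents_def tdeg_def)

lemma r_0 [simp]: "r N 0 = 1"
  by (simp add: r_def exponents_0)

text \<open>Every exponent of positive total degree contains an indeterminate, which can be split off.\<close>

lemma exponents_split:
  assumes \<alpha>: "\<alpha> \<in> exponents N n" and n: "n \<ge> 1"
  obtains m i \<beta> where "m \<in> {1..n}" "i \<in> {1..N m}" "\<beta> \<in> exponents N (n - m)"
    "\<alpha> = Poly_Mapping.single (m, i) 1 + \<beta>"
proof -
  have "\<alpha> \<noteq> 0" using \<alpha> n by (auto simp: exponents_def tdeg_def)
  then have "Poly_Mapping.keys \<alpha> \<noteq> {}" by simp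
  then obtain m i where mi: "(m, i) \<in> Poly_Mapping.keys \<alpha>" by (metis ex_in_conv surj_pair)
  define \<beta> where "\<beta> = \<alpha> - Poly_Mapping.single (m, i) 1"
  have eq: "\<alpha> = Poly_Mapping.single (m, i) 1 + \<beta>"
    using mi by (intro poly_mapping_eqI)
      (auto simp: \<beta>_def lookup_add lookup_minus lookup_single when_def in_keys_iff)
  have "m \<ge> 1" "i \<in> {1..N m}" using \<alpha> mi by (auto simp: exponents_def indets_def)
  moreover have "tdeg \<alpha> = m + tdeg \<beta>" by (subst eq) (simp add: tdeg_add)
  moreover have "Poly_Mapping.keys \<beta> \<subseteq> indets N"
    using \<alpha> unfolding exponents_def by (subst (asm) eq) (simp add: keys_add_nat)
  ultimately show thesis
    using \<alpha> by (intro that[OF _ _ _ eq]) (auto simp: exponents_def)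
qed

text \<open>
  The increasing filtration of \<open>Sym N\<close> by total degree; the bound is strict, so that the space
  with index \<open>0\<close> is zero.
\<close>

definition Sym_less :: "(nat \<Rightarrow> nat) \<Rightarrow> nat \<Rightarrow> sympoly set" where
  "Sym_less N n = {P \<in> Sym N. \<forall>\<alpha>\<in>Poly_Mapping.keys P. tdeg \<alpha> < n}"

lemma Sym_iff: "P \<in> Sym N \<longleftrightarrow>
    (\<forall>\<alpha>. Poly_Mapping.lookup P \<alpha> \<noteq> 0 \<longrightarrow> Poly_Mapping.keys \<alpha> \<subseteq> indets N)"
  by (auto simp: Sym_def in_keys_iff)

lemma Sym_less_iff: "P \<in> Sym_less N n \<longleftrightarrow>
    (\<forall>\<alpha>. Poly_Mapping.lookup P \<alpha> \<noteq> 0 \<longrightarrow> Poly_Mapping.keys \<alpha> \<subseteq> indets N \<and> tdeg \<alpha> < n)"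
  by (auto simp: Sym_less_def Sym_def in_keys_iff)

lemma subspace_Sym: "Real_Vector_Spaces.subspace (Sym N)"
  unfolding Real_Vector_Spaces.subspace_def Sym_def
  by (auto simp: in_keys_iff dest!: keys_add[THEN subsetD])

lemma subspace_Sym_less: "Real_Vector_Spaces.subspace (Sym_less N n)"
  unfolding Real_Vector_Spaces.subspace_def Sym_less_def Sym_def
  by (auto simp: in_keys_iff dest!: keys_add[THEN subsetD])

lemma Sym_less_0 [simp]: "Sym_less N 0 = {0}"
  by (auto simp: Sym_less_iff intro!: poly_mapping_eqI)

lemma Sym_less_mono: "m \<le> n \<Longrightarrow> Sym_less N m \<subseteq> Sym_less N n"
  by (auto simp: Sym_less_def)

lemma Sym_less_subset: "Sym_less N n \<subseteq> Sym N"
  by (auto simp: Sym_less_def)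

lemma Sym_in_Sym_less:
  assumes "P \<in> Sym N" obtains n where "P \<in> Sym_less N n"
proof -
  have "tdeg \<alpha> < Suc (\<Sum>\<alpha>\<in>Poly_Mapping.keys P. tdeg \<alpha>)" if "\<alpha> \<in> Poly_Mapping.keys P" for \<alpha>
    using that by (intro le_imp_less_Suc member_le_sum) auto
  then show thesis using assms that unfolding Sym_less_def by blast
qed

lemma monomial_mult_Sym_less:
  assumes "\<gamma> \<in> exponents N m" "P \<in> Sym_less N n"
  shows "Poly_Mapping.single \<gamma> 1 * P \<in> Sym_less N (m + n)"
  using assms by (auto simp: Sym_less_def Sym_def keys_single_mult exponents_def tdeg_add keys_add_nat)

lemma indet_mult_Sym_less:
  "1 \<le> m \<Longrightarrow> i \<in> {1..N m} \<Longrightarrow> P \<in> Sym_less N n \<Longrightarrow> indet m i * P \<in> Sym_less N (m + n)"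
  unfolding indet_def by (intro monomial_mult_Sym_less single_in_exponents)

lemma linear_sum_scaleR:
  fixes L :: "sympoly \<Rightarrow> real"
  assumes "linear L"
  shows "L (\<Sum>a\<in>A. x a *\<^sub>R q a) = (\<Sum>a\<in>A. L (q a) * x a)"
  by (simp add: linear_sum[OF assms] linear_cmul[OF assms] mult.commute)

section \<open>Graded families and their leading coefficients\<close>

text \<open>
  An enumeration \<open>e n\<close> of the exponents of each total degree \<open>n\<close>, and a family \<open>p n a\<close> of elements
  of \<open>Sym N\<close> with \<open>r N n\<close> members in degree \<open>n\<close>.
\<close>

locale graded_family =
  fixes N :: "nat \<Rightarrow> nat" and e :: "nat \<Rightarrow> nat \<Rightarrow> exponent" and p :: "nat \<Rightarrow> nat \<Rightarrow> sympoly"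
  assumes e_bij: "bij_betw (e n) {..<r N n} (exponents N n)"
    and p_Sym: "a < r N n \<Longrightarrow> p n a \<in> Sym N"
begin

text \<open>The entries of the monomial vector \<open>w_n\<close>.\<close>

abbreviation wmon :: "nat \<Rightarrow> nat \<Rightarrow> sympoly" where
  "wmon n l \<equiv> Poly_Mapping.single (e n l) 1"

text \<open>Linear combination of the entries in degree \<open>n\<close>.\<close>

definition comb :: "nat \<Rightarrow> (nat \<Rightarrow> real) \<Rightarrow> sympoly" where
  "comb n x = (\<Sum>a<r N n. x a *\<^sub>R p n a)"

lemma e_exponents: "l < r N n \<Longrightarrow> e n l \<in> exponents N n"
  using e_bij bij_betwE by blast

lemma e_surj: "\<alpha> \<in> exponents N n \<Longrightarrow> \<exists>l<r N n. \<alpha> = e n l"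
  using e_bij[of n] by (force simp: bij_betw_def)

lemma e_inj: "l < r N n \<Longrightarrow> k < r N n \<Longrightarrow> e n l = e n k \<longleftrightarrow> l = k"
  using e_bij[of n] by (auto simp: bij_betw_def inj_on_def)

lemma wmon_Sym_less: "l < r N n \<Longrightarrow> wmon n l \<in> Sym_less N (Suc n)"
  using e_exponents[of l n] by (auto simp: Sym_less_def Sym_def exponents_def)

lemma wmon_0: "l < r N 0 \<Longrightarrow> wmon 0 l = 1"
  using e_exponents[of l 0] by (simp add: exponents_0)

lemma indet_mult_wmon:
  assumes "m \<in> {1..n}" "i \<in> {1..N m}" "l < r N (n - m)"
  obtains l' where "l' < r N n" "e n l' = Poly_Mapping.single (m, i) 1 + e (n - m) l"
    "indet m i * wmon (n - m) l = wmon n l'"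
proof -
  have "Poly_Mapping.single (m, i) 1 + e (n - m) l \<in> exponents N (m + (n - m))"
    using assms by (intro exponents_add single_in_exponents e_exponents) auto
  moreover have "m + (n - m) = n" using assms by simp
  ultimately obtain l' where "l' < r N n" "Poly_Mapping.single (m, i) 1 + e (n - m) l = e n l'"
    using e_surj by metis
  then show thesis by (intro that[of l']) (auto simp: indet_def mult_single)
qed

lemma wmon_split:
  assumes "1 \<le> n" "l < r N n"
  obtains m i l' where "m \<in> {1..n}" "i \<in> {1..N m}" "l' < r N (n - m)"
    "e n l = Poly_Mapping.single (m, i) 1 + e (n - m) l'" "wmon n l = indet m i * wmon (n - m) l'"
proof -
  obtain m i \<beta> where mi: "m \<in> {1..n}" "i \<in> {1..N m}" and \<beta>: "\<beta> \<in> exponents N (n - m)"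
    and eq: "e n l = Poly_Mapping.single (m, i) 1 + \<beta>"
    using exponents_split[OF e_exponents[OF assms(2)] assms(1)] by blast
  obtain l' where "l' < r N (n - m)" "\<beta> = e (n - m) l'" using e_surj[OF \<beta>] by blast
  with mi eq show thesis by (intro that[of m i l']) (auto simp: indet_def mult_single)
qed

lemma Sym_less_SucD:
  assumes "P \<in> Sym_less N (Suc n)" "\<And>l. l < r N n \<Longrightarrow> Poly_Mapping.lookup P (e n l) = 0"
  shows "P \<in> Sym_less N n"
  unfolding Sym_less_iff
proof (intro allI impI)
  fix \<alpha> assume nz: "Poly_Mapping.lookup P \<alpha> \<noteq> 0"
  then have \<alpha>: "Poly_Mapping.keys \<alpha> \<subseteq> indets N" "tdeg \<alpha> < Suc n"
    using assms(1) unfolding Sym_less_iff by blast+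
  have "\<alpha> \<notin> exponents N n" using nz assms(2) e_surj by blast
  then show "Poly_Mapping.keys \<alpha> \<subseteq> indets N \<and> tdeg \<alpha> < n"
    using \<alpha> by (auto simp: exponents_def)
qed

lemma lookup_Sym_less:
  "P \<in> Sym_less N n \<Longrightarrow> n \<le> m \<Longrightarrow> l < r N m \<Longrightarrow> Poly_Mapping.lookup P (e m l) = 0"
  using e_exponents[of l m] by (auto simp: Sym_less_iff exponents_def)

lemma lookup_wmon: "l < r N n \<Longrightarrow> k < r N n \<Longrightarrow>
    Poly_Mapping.lookup (wmon n l) (e n k) = (if l = k then 1 else 0)"
  by (auto simp: lookup_single when_def e_inj)

text \<open>Monomials span the filtration; this is used in the form of a statement on functionals.\<close>

lemma linear_vanishes_Sym_less:
  fixes L :: "sympoly \<Rightarrow> real"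
  assumes L: "linear L" and "\<And>j l. j < n \<Longrightarrow> l < r N j \<Longrightarrow> L (wmon j l) = 0"
    and P: "P \<in> Sym_less N n"
  shows "L P = 0"
  using assms(2) P
proof (induction n arbitrary: P)
  case 0
  then show ?case using linear_0[OF L] by simp
next
  case (Suc n)
  define Q where "Q = (\<Sum>l<r N n. Poly_Mapping.lookup P (e n l) *\<^sub>R wmon n l)"
  have "Q \<in> Sym_less N (Suc n)"
    unfolding Q_def by (intro subspace_sum subspace_scale subspace_Sym_less wmon_Sym_less) auto
  then have "P - Q \<in> Sym_less N (Suc n)"
    using Suc.prems by (intro subspace_diff subspace_Sym_less)
  then have "P - Q \<in> Sym_less N n"
    by (rule Sym_less_SucD)
      (simp add: Q_def lookup_minus lookup_sum lookup_wmon if_distrib sum.delta cong: if_cong)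
  then have "L (P - Q) = 0" using Suc by simp
  moreover have "L Q = 0" using Suc.prems(1) by (simp add: Q_def linear_sum_scaleR[OF L])
  ultimately show ?case using linear_diff[OF L] by simp
qed

lemma comb_cong: "(\<And>a. a < r N n \<Longrightarrow> x a = y a) \<Longrightarrow> comb n x = comb n y"
  by (simp add: comb_def)

lemma comb_0 [simp]: "comb n (\<lambda>_. 0) = 0"
  by (simp add: comb_def)

lemma comb_zero: "(\<And>a. a < r N n \<Longrightarrow> x a = 0) \<Longrightarrow> comb n x = 0"
  by (simp add: comb_def)

lemma comb_Sym: "comb n x \<in> Sym N"
  unfolding comb_def by (intro subspace_sum subspace_scale subspace_Sym p_Sym) auto

lemma lookup_comb: "Poly_Mapping.lookup (comb n x) \<alpha> = (\<Sum>b<r N n. Poly_Mapping.lookup (p n b) \<alpha> * x b)"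
  by (simp add: comb_def lookup_sum mult.commute)

lemma linear_mult_comb:
  fixes L :: "sympoly \<Rightarrow> real"
  assumes "linear L"
  shows "L (q * comb n x) = (\<Sum>b<r N n. L (q * p n b) * x b)"
  by (simp add: comb_def sum_distrib_left linear_sum_scaleR[OF assms])

text \<open>The degree bound on the entries.\<close>

definition deg_bound :: "nat \<Rightarrow> bool" where
  "deg_bound n \<longleftrightarrow> (\<forall>a<r N n. p n a \<in> Sym_less N (Suc n))"

text \<open>
  Nondegeneracy of the matrix \<open>G_n\<close> of the leading coefficients in \<open>p_n = G_n w_n + \<dots>\<close>.
\<close>

definition lead :: "nat \<Rightarrow> bool" where
  "lead n \<longleftrightarrow> nondeg (r N n) (\<lambda>b l. Poly_Mapping.lookup (p n b) (e n l))"

lemma lead_transpose: "lead n \<longleftrightarrow> nondeg (r N n) (\<lambda>l b. Poly_Mapping.lookup (p n b) (e n l))"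
  unfolding lead_def by (rule nondeg_transpose[symmetric])

lemma comb_Sym_less: "deg_bound n \<Longrightarrow> comb n x \<in> Sym_less N (Suc n)"
  unfolding comb_def deg_bound_def
  by (intro subspace_sum subspace_scale subspace_Sym_less) auto

lemma lead_comb_zero:
  assumes "lead n" "comb n x \<in> Sym_less N n" "a < r N n"
  shows "x a = 0"
proof (rule nondegD)
  show "nondeg (r N n) (\<lambda>l b. Poly_Mapping.lookup (p n b) (e n l))"
    using assms(1) lead_transpose by blast
  show "(\<Sum>b<r N n. Poly_Mapping.lookup (p n b) (e n l) * x b) = 0" if "l < r N n" for l
    using lookup_Sym_less[OF assms(2) order_refl that] by (simp add: lookup_comb)
qed fact

text \<open>
  Cancelling the top degree successively expands a polynomial in the entries of the family, and
  \<open>comb_sum_zero\<close> below shows that the coefficients are unique.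
\<close>

lemma expand_Sym_less:
  assumes "\<And>j. j < n \<Longrightarrow> deg_bound j \<and> lead j" "P \<in> Sym_less N n"
  shows "\<exists>X. P = (\<Sum>j<n. comb j (X j))"
  using assms
proof (induction n arbitrary: P)
  case (Suc n)
  have dl: "deg_bound n" "lead n" using Suc.prems(1)[of n] by auto
  obtain x where x: "\<And>l. l < r N n \<Longrightarrow>
      (\<Sum>b<r N n. Poly_Mapping.lookup (p n b) (e n l) * x b) = Poly_Mapping.lookup P (e n l)"
    using nondeg_solvable[OF dl(2)[unfolded lead_transpose],
        of "\<lambda>l. Poly_Mapping.lookup P (e n l)"] by blast
  have "P - comb n x \<in> Sym_less N (Suc n)"
    using Suc.prems(2) dl by (intro subspace_diff subspace_Sym_less comb_Sym_less)
  then have "P - comb n x \<in> Sym_less N n"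
    by (rule Sym_less_SucD) (simp add: lookup_minus lookup_comb x)
  then obtain X where X: "P - comb n x = (\<Sum>j<n. comb j (X j))"
    using Suc by force
  have "P = (\<Sum>j<Suc n. comb j ((X(n := x)) j))"
    using X by (simp add: algebra_simps)
  then show ?case by blast
qed auto

lemma comb_sum_zero:
  assumes "\<And>j. j < n \<Longrightarrow> deg_bound j \<and> lead j" "(\<Sum>j<n. comb j (X j)) = 0" "j < n" "a < r N j"
  shows "X j a = 0"
  using assms
proof (induction n)
  case (Suc n)
  have "comb n (X n) = - (\<Sum>j<n. comb j (X j))"
    using Suc.prems(2) by (simp add: eq_neg_iff_add_eq_0 add.commute)
  also have "\<dots> \<in> Sym_less N n"
  proof (intro subspace_neg subspace_sum subspace_Sym_less)
    fix j assume "j \<in> {..<n}"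
    then show "comb j (X j) \<in> Sym_less N n"
      using comb_Sym_less[of j "X j"] Sym_less_mono[of "Suc j" n] Suc.prems(1)[of j] by auto
  qed
  finally have top: "X n b = 0" if "b < r N n" for b
    using lead_comb_zero that Suc.prems(1)[of n] by blast
  then have "comb n (X n) = 0" by (rule comb_zero)
  then have "(\<Sum>j<n. comb j (X j)) = 0" using Suc.prems(2) by simp
  then show ?case using Suc top by (cases "j = n") auto
qed auto

lemma p_eq_comb: "a < r N n \<Longrightarrow> p n a = comb n (\<lambda>b. if b = a then 1 else 0)"
  by (simp add: comb_def if_distrib[where f = "\<lambda>c. c *\<^sub>R _"] sum.delta cong: if_cong)

text \<open>With invertible leading coefficients, the entries of all degrees form a basis of \<open>Sym N\<close>.\<close>

lemma family_basis:
  assumes dl: "\<And>n. deg_bound n \<and> lead n"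
  defines "J \<equiv> SIGMA n:UNIV. {..<r N n}"
  shows "inj_on (\<lambda>(n, a). p n a) J" "basis_of (Sym N) ((\<lambda>(n, a). p n a) ` J)"
proof -
  let ?f = "\<lambda>(n, a). p n a"
  \<comment> \<open>Finite linear relations between the members of the family are trivial.\<close>
  have comb_finite: "c x = 0" if fin: "finite K" and K: "K \<subseteq> J" and x: "x \<in> K"
    and z: "(\<Sum>x\<in>K. c x *\<^sub>R ?f x) = 0" for K c x
  proof -
    obtain n where n: "fst ` K \<subseteq> {..<n}"
      using fin finite_nat_iff_bounded by (metis finite_imageI)
    define X where "X j a = (if (j, a) \<in> K then c (j, a) else 0)" for j a
    have "(\<Sum>j<n. comb j (X j)) = (\<Sum>x\<in>(SIGMA j:{..<n}. {..<r N j}). X (fst x) (snd x) *\<^sub>R ?f x)"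
      by (simp add: comb_def sum.Sigma case_prod_unfold)
    also have "\<dots> = (\<Sum>x\<in>K. c x *\<^sub>R ?f x)"
      using n K by (intro sum.mono_neutral_cong_right) (auto simp: X_def J_def)
    finally have "(\<Sum>j<n. comb j (X j)) = 0" using z by simp
    then have "X (fst x) (snd x) = 0"
      using n K x by (intro comb_sum_zero[of n]) (use dl in \<open>auto simp: J_def\<close>)
    then show ?thesis using x by (simp add: X_def)
  qed
  show inj: "inj_on ?f J"
  proof (rule inj_onI, rule ccontr)
    fix x y assume xy: "x \<in> J" "y \<in> J" "?f x = ?f y" "x \<noteq> y"
    define c :: "nat \<times> nat \<Rightarrow> real" where "c z = (if z = x then 1 else -1)" for z
    have "c x = 0" by (rule comb_finite[of "{x, y}"]) (use xy in \<open>auto simp: c_def\<close>)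
    then show False by (simp add: c_def)
  qed
  have "Real_Vector_Spaces.independent (?f ` J)"
  proof
    assume "Real_Vector_Spaces.dependent (?f ` J)"
    then obtain S u where S: "finite S" "S \<subseteq> ?f ` J" "(\<Sum>v\<in>S. u v *\<^sub>R v) = 0"
      and "\<exists>v\<in>S. u v \<noteq> 0"
      unfolding dependent_explicit by blast
    then obtain v where v: "v \<in> S" "u v \<noteq> 0" by blast
    obtain K where K: "K \<subseteq> J" "S = ?f ` K" using S(2) by (auto simp: subset_image_iff)
    then have injK: "inj_on ?f K" using inj inj_on_subset by blast
    obtain x where x: "x \<in> K" "v = ?f x" using v K by blast
    have "u (?f x) = 0"
      using S K x injK
      by (intro comb_finite[of K x "\<lambda>x. u (?f x)"]) (auto simp: sum.reindex finite_image_iff)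
    then show False using v x by simp
  qed
  moreover have "Real_Vector_Spaces.span (?f ` J) = Sym N"
  proof
    show "Real_Vector_Spaces.span (?f ` J) \<subseteq> Sym N"
      by (rule span_minimal[OF _ subspace_Sym]) (auto simp: J_def p_Sym)
    show "Sym N \<subseteq> Real_Vector_Spaces.span (?f ` J)"
    proof
      fix P assume "P \<in> Sym N"
      then obtain n where "P \<in> Sym_less N n" by (rule Sym_in_Sym_less)
      then obtain X where "P = (\<Sum>j<n. comb j (X j))" using expand_Sym_less dl by blast
      moreover have "comb j (X j) \<in> Real_Vector_Spaces.span (?f ` J)" for j
        unfolding comb_def
      proof (intro span_sum span_scale span_base)
        fix a assume "a \<in> {..<r N j}"
        then show "p j a \<in> ?f ` J" by (intro image_eqI[of _ _ "(j, a)"]) (auto simp: J_def)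
      qed
      ultimately show "P \<in> Real_Vector_Spaces.span (?f ` J)" by (auto intro: span_sum)
    qed
  qed
  ultimately show "basis_of (Sym N) (?f ` J)" by (simp add: basis_of_def)
qed

end

section \<open>Block orthogonality with respect to a functional\<close>

text \<open>The form is diagonal on \<open>B\<close> with nonzero diagonal entries.\<close>

definition diagonal_on :: "('a \<Rightarrow> 'a \<Rightarrow> real) \<Rightarrow> 'a set \<Rightarrow> bool" where
  "diagonal_on f B \<longleftrightarrow> (\<forall>u\<in>B. \<forall>v\<in>B. u \<noteq> v \<longrightarrow> f u v = 0) \<and> (\<forall>u\<in>B. f u u \<noteq> 0)"

lemma diagonal_independent:
  fixes f :: "'a::real_vector \<Rightarrow> 'a \<Rightarrow> real"
  assumes lin: "\<And>u. linear (f u)" and B: "diagonal_on f B"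
  shows "Real_Vector_Spaces.independent B"
proof
  assume "Real_Vector_Spaces.dependent B"
  then obtain S u where S: "finite S" "S \<subseteq> B" "(\<Sum>v\<in>S. u v *\<^sub>R v) = 0" and "\<exists>v\<in>S. u v \<noteq> 0"
    unfolding dependent_explicit by blast
  then obtain v where v: "v \<in> S" "u v \<noteq> 0" by blast
  have "0 = f v (\<Sum>v\<in>S. u v *\<^sub>R v)" using S(3) linear_0[OF lin] by simp
  also have "\<dots> = (\<Sum>x\<in>S. u x * f v x)" by (simp add: linear_sum[OF lin] linear_cmul[OF lin])
  also have "\<dots> = (\<Sum>x\<in>S. if x = v then u v * f v v else 0)"
  proof (intro sum.cong refl)
    fix x assume "x \<in> S"
    then have "v \<noteq> x \<Longrightarrow> f v x = 0" using B S(2) v(1) unfolding diagonal_on_def by blast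
    then show "u x * f v x = (if x = v then u v * f v v else 0)" by auto
  qed
  also have "\<dots> = u v * f v v" using S(1) v(1) by (simp add: sum.delta)
  finally show False using B S(2) v by (auto simp: diagonal_on_def)
qed

text \<open>
  A nondegenerate symmetric bilinear form on a finite-dimensional space has an orthogonal basis
  without isotropic vectors. Such a basis is an orthogonal family \<open>B\<close> of maximal cardinality:
  a nonzero vector orthogonal to \<open>B\<close> would pair nontrivially with another such vector, and by
  polarization one of the two or their sum would not be isotropic and could be added to \<open>B\<close>.
\<close>

lemma orthogonal_basis:
  fixes f :: "'a::real_vector \<Rightarrow> 'a \<Rightarrow> real"
  assumes lin: "\<And>u. linear (f u)" and sym: "\<And>u v. f u v = f v u"
    and fin: "finite S"
    and nd: "\<And>u. u \<in> Real_Vector_Spaces.span S \<Longrightarrow> (\<And>v. v \<in> Real_Vector_Spaces.span S \<Longrightarrow> f u v = 0) \<Longrightarrow> u = 0"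
  obtains B where "diagonal_on f B" "Real_Vector_Spaces.span B = Real_Vector_Spaces.span S"
proof -
  let ?U = "Real_Vector_Spaces.span S"
  define C where "C = {B. B \<subseteq> ?U \<and> diagonal_on f B}"
  have bound: "finite B \<and> card B \<le> card S" if "B \<in> C" for B
    using that independent_span_bound[OF fin diagonal_independent[OF lin]] by (auto simp: C_def)
  have "{} \<in> C" by (simp add: C_def diagonal_on_def)
  then have "\<exists>B. B \<in> C \<and> (\<forall>B'. B' \<in> C \<longrightarrow> card B' \<le> card B)"
    using bound by (intro ex_has_greatest_nat[of "\<lambda>B. B \<in> C" "{}" card "Suc (card S)"])
      (auto intro: le_imp_less_Suc le_SucI)
  then obtain B where B: "B \<in> C" and max: "\<And>B'. B' \<in> C \<Longrightarrow> card B' \<le> card B"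
    by blast
  have finB: "finite B" and BU: "B \<subseteq> ?U" and diag: "diagonal_on f B"
    using B bound by (auto simp: C_def)
  have lin': "linear (\<lambda>u. f u v)" for v using lin[of v] by (simp add: sym[of _ v])
  define proj where "proj u = (\<Sum>b\<in>B. (f u b / f b b) *\<^sub>R b)" for u
  have projB: "proj u \<in> Real_Vector_Spaces.span B" for u
    unfolding proj_def by (intro span_sum span_scale span_base)
  have projU: "proj u \<in> ?U" for u
    using projB span_mono[OF BU] by (auto simp: span_span)
  have perp: "f (u - proj u) b = 0" if b: "b \<in> B" for u b
  proof -
    have "f (proj u) b = (\<Sum>c\<in>B. (f u c / f c c) * f c b)"
      by (simp add: proj_def linear_sum[OF lin'] linear_cmul[OF lin'])
    also have "\<dots> = (\<Sum>c\<in>B. if c = b then f u b else 0)"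
      using diag b by (intro sum.cong) (auto simp: diagonal_on_def)
    also have "\<dots> = f u b" using finB b by (simp add: sum.delta)
    finally show ?thesis by (simp add: linear_diff[OF lin'])
  qed
  have isotropic: "f w w = 0" if w: "w \<in> ?U" "\<And>b. b \<in> B \<Longrightarrow> f w b = 0" for w
  proof (rule ccontr)
    assume nz: "f w w \<noteq> 0"
    then have "w \<notin> B" using w by auto
    moreover have "f b w = 0" if "b \<in> B" for b
      using w(2)[OF that] sym[of b w] by simp
    then have "insert w B \<in> C"
      using w nz BU diag by (auto simp: C_def diagonal_on_def)
    ultimately show False using max[of "insert w B"] finB by simp
  qed
  have perp_zero: "w = 0" if w: "w \<in> ?U" "\<And>b. b \<in> B \<Longrightarrow> f w b = 0" for w
  proof (rule nd)
    fix v assume v: "v \<in> ?U"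
    let ?v = "v - proj v"
    have v': "?v \<in> ?U" using v projU by (intro span_diff)
    have "f (w + ?v) (w + ?v) = 0"
      by (rule isotropic) (use w v' perp in \<open>auto simp: linear_add[OF lin'] intro: span_add\<close>)
    moreover have "f w w = 0" by (rule isotropic) (use w in auto)
    moreover have "f ?v ?v = 0" by (rule isotropic) (use v' perp in auto)
    moreover have "f (w + ?v) (w + ?v) = f w w + 2 * f w ?v + f ?v ?v"
      using sym[of ?v w] by (simp add: linear_add[OF lin'] linear_add[OF lin])
    ultimately have "f w ?v = 0" by simp
    moreover have "f w (proj v) = 0"
      using w(2) by (simp add: proj_def linear_sum[OF lin] linear_cmul[OF lin])
    ultimately show "f w v = 0" by (simp add: linear_diff[OF lin])
  qed (rule w(1))
  have "u \<in> Real_Vector_Spaces.span B" if "u \<in> ?U" for u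
  proof -
    have "u - proj u = 0" using that projU perp by (intro perp_zero span_diff)
    then show ?thesis using projB[of u] by simp
  qed
  moreover have "Real_Vector_Spaces.span B \<subseteq> ?U" by (rule span_minimal[OF BU subspace_span])
  ultimately have "Real_Vector_Spaces.span B = ?U" by blast
  then show thesis using that diag by blast
qed

text \<open>
  A graded family together with a functional. The functional is linear on the whole type of
  polynomials and not only on \<open>Sym N\<close>; a functional on \<open>Sym N\<close> extends in this way.
\<close>

locale graded_functional = graded_family +
  fixes L :: "sympoly \<Rightarrow> real"
  assumes linear_L: "linear L"
begin

text \<open>The blocks \<open>(w_m, p_n\<^sup>T)\<close> with \<open>m < n\<close> vanish.\<close>

definition orth :: "nat \<Rightarrow> bool" where
  "orth n \<longleftrightarrow> (\<forall>m<n. \<forall>l<r N m. \<forall>a<r N n. L (wmon m l * p n a) = 0)"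

text \<open>Nondegeneracy of the matrix \<open>(w_n, p_n\<^sup>T)\<close>.\<close>

definition pairing :: "nat \<Rightarrow> bool" where
  "pairing n \<longleftrightarrow> nondeg (r N n) (\<lambda>l b. L (wmon n l * p n b))"

lemma linear_L_mult: "linear (\<lambda>P. L (P * q))"
  by (rule linearI) (simp_all add: distrib_right linear_add[OF linear_L] linear_cmul[OF linear_L])

lemma linear_L_mult_left: "linear (\<lambda>P. L (q * P))"
  by (rule linearI) (simp_all add: distrib_left linear_add[OF linear_L] linear_cmul[OF linear_L])

lemma lower_orth:
  assumes "orth n" "P \<in> Sym_less N n"
  shows "L (P * comb n x) = 0"
proof (rule linear_vanishes_Sym_less[OF linear_L_mult _ assms(2)])
  show "L (wmon j l * comb n x) = 0" if "j < n" "l < r N j" for j l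
    using assms(1) that by (simp add: linear_mult_comb[OF linear_L] orth_def)
qed

lemma wmon_comb_orth: "orth n \<Longrightarrow> m < n \<Longrightarrow> l < r N m \<Longrightarrow> L (wmon m l * comb n x) = 0"
  using lower_orth wmon_Sym_less Sym_less_mono[of "Suc m" n] by (meson Suc_leI subsetD)

text \<open>
  The blocks \<open>(w_m, p_n\<^sup>T)\<close> form a triangular array with invertible diagonal, so the
  coefficients of an expansion are determined successively by its products with monomials.
\<close>

lemma triangular:
  assumes "\<And>j. j < n \<Longrightarrow> orth j \<and> pairing j"
    and q: "q = (\<Sum>j<n. comb j (X j))"
    and zero: "\<And>j l. j < k \<Longrightarrow> l < r N j \<Longrightarrow> L (wmon j l * q) = 0"
    and "k \<le> n" "j < k" "a < r N j"
  shows "X j a = 0"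
  using assms(5,6)
proof (induction j arbitrary: a rule: less_induct)
  case (less j)
  have jn: "j < n" using less.prems assms(4) by simp
  show ?case
  proof (rule nondegD[where x = "X j"])
    show "nondeg (r N j) (\<lambda>l b. L (wmon j l * p j b))"
      using assms(1)[OF jn] by (simp add: pairing_def)
    show "(\<Sum>b<r N j. L (wmon j l * p j b) * X j b) = 0" if l: "l < r N j" for l
    proof -
      have "L (wmon j l * q) = (\<Sum>i<n. L (wmon j l * comb i (X i)))"
        by (simp add: q sum_distrib_left linear_sum[OF linear_L])
      also have "\<dots> = (\<Sum>i<n. if i = j then L (wmon j l * comb j (X j)) else 0)"
      proof (intro sum.cong refl)
        fix i assume i: "i \<in> {..<n}"
        consider "i < j" | "i = j" | "i > j" by linarith
        then show "L (wmon j l * comb i (X i)) = (if i = j then L (wmon j l * comb j (X j)) else 0)"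
        proof cases
          case 1
          then have "comb i (X i) = 0" using less by (intro comb_zero) auto
          then show ?thesis using 1 by (simp add: linear_0[OF linear_L])
        qed (use i assms(1) wmon_comb_orth l in auto)
      qed
      also have "\<dots> = L (wmon j l * comb j (X j))" using jn by simp
      finally show ?thesis using zero[OF less.prems(1) l] by (simp add: linear_mult_comb[OF linear_L])
    qed
  qed fact
qed

text \<open>
  Under block orthogonality the leading coefficients are nondegenerate: a combination of the
  entries of \<open>p_n\<close> of total degree less than \<open>n\<close> is a combination of \<open>p_j\<close> with \<open>j < n\<close> that
  is orthogonal to all monomials of degree less than \<open>n\<close>. It therefore vanishes, and so do its
  coefficients, because \<open>(w_n, p_n\<^sup>T)\<close> is invertible.
\<close>

lemma lead_of_pairing:
  assumes "\<And>n. deg_bound n \<and> orth n \<and> pairing n"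
  shows "lead n"
proof (induction n rule: less_induct)
  case (less n)
  have "x a = 0" if x: "\<And>l. l < r N n \<Longrightarrow> (\<Sum>b<r N n. Poly_Mapping.lookup (p n b) (e n l) * x b) = 0"
    and a: "a < r N n" for x a
  proof -
    have "comb n x \<in> Sym_less N n"
      by (rule Sym_less_SucD[OF comb_Sym_less]) (use assms x in \<open>auto simp: lookup_comb\<close>)
    then obtain X where X: "comb n x = (\<Sum>j<n. comb j (X j))"
      using expand_Sym_less[of n] less assms by blast
    have "X j b = 0" if "j < n" "b < r N j" for j b
      by (rule triangular[OF _ X]) (use assms that wmon_comb_orth in auto)
    then have "comb n x = 0" using X comb_zero by simp
    then have "(\<Sum>b<r N n. L (wmon n l * p n b) * x b) = 0" for l
      using linear_mult_comb[OF linear_L, of "wmon n l" n x] by (simp add: linear_0[OF linear_L])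
    then show ?thesis using assms[of n] a unfolding pairing_def by (intro nondegD) blast+
  qed
  then show ?case unfolding lead_transpose nondeg_def by blast
qed

text \<open>
  Block orthogonality and the diagonalization of each block give an orthogonal basis of \<open>Sym N\<close>.
\<close>

lemma quasi_definite_L:
  assumes *: "\<And>n. deg_bound n \<and> lead n \<and> orth n \<and> pairing n"
  shows "quasi_definite N L"
proof -
  let ?f = "\<lambda>P Q. L (P * Q)"
  let ?S = "\<lambda>n. p n ` {..<r N n}"
  have span_comb: "\<exists>x. P = comb n x" if "P \<in> Real_Vector_Spaces.span (?S n)" for P n
    using that
  proof (induction rule: span_induct_alt)
    case base
    then show ?case using comb_0 by metis
  next
    case (step c Q P)
    then obtain a x where a: "a < r N n" "Q = p n a" and P: "P = comb n x" by blast
    have "c *\<^sub>R Q + P = comb n (\<lambda>b. c * (if b = a then 1 else 0) + x b)"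
      unfolding a P p_eq_comb[OF a(1)]
      by (simp add: comb_def scaleR_add_left sum.distrib scaleR_sum_right)
    then show ?case by blast
  qed
  have comb_span: "comb n x \<in> Real_Vector_Spaces.span (?S n)" for n x
    unfolding comb_def by (intro span_sum span_scale span_base) auto
  have "\<exists>B. diagonal_on ?f B \<and> Real_Vector_Spaces.span B = Real_Vector_Spaces.span (?S n)" for n
  proof (rule orthogonal_basis[where f = ?f and S = "?S n"])
    fix u assume u: "u \<in> Real_Vector_Spaces.span (?S n)"
      and zero: "\<And>v. v \<in> Real_Vector_Spaces.span (?S n) \<Longrightarrow> L (u * v) = 0"
    obtain x where x: "u = comb n x" using span_comb u by blast
    have "(\<Sum>b<r N n. L (wmon n l * p n b) * x b) = 0" if l: "l < r N n" for l
    proof -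
      obtain X where X: "wmon n l = (\<Sum>j<Suc n. comb j (X j))"
        using expand_Sym_less[OF _ wmon_Sym_less[OF l]] * by blast
      have "L (comb j (X j) * comb n x) = 0" if "j < Suc n" for j
      proof (cases "j = n")
        case True
        then show ?thesis using zero[OF comb_span, of "X j"] x by (simp add: mult.commute)
      next
        case False
        then have "comb j (X j) \<in> Sym_less N n"
          using comb_Sym_less[of j "X j"] * Sym_less_mono[of "Suc j" n] that by auto
        then show ?thesis using lower_orth * by blast
      qed
      then have "L (wmon n l * comb n x) = 0"
        unfolding X by (simp add: sum_distrib_right linear_sum[OF linear_L] del: sum.lessThan_Suc)
      then show ?thesis by (simp add: linear_mult_comb[OF linear_L])
    qed
    then have "x b = 0" if "b < r N n" for b
      using *[of n] that unfolding pairing_def by (intro nondegD) blast+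
    then show "u = 0" unfolding x by (rule comb_zero)
  qed (auto intro: linear_L_mult_left simp: mult.commute)
  then obtain B where B: "\<And>n. diagonal_on ?f (B n)"
    and spanB: "\<And>n. Real_Vector_Spaces.span (B n) = Real_Vector_Spaces.span (?S n)" by metis
  have B_comb: "\<exists>x. P = comb n x" if "P \<in> B n" for P n
    using span_comb[of P n] span_base[OF that] spanB[of n] by simp
  have cross: "L (P * Q) = 0" if "P \<in> B n" "Q \<in> B m" "n < m" for P Q n m
  proof -
    obtain x y where "P = comb n x" "Q = comb m y"
      using B_comb[OF \<open>P \<in> B n\<close>] B_comb[OF \<open>Q \<in> B m\<close>] by blast
    moreover have "comb n x \<in> Sym_less N m"
      using comb_Sym_less[of n x] * Sym_less_mono[of "Suc n" m] that by auto
    ultimately show ?thesis using lower_orth * by blast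
  qed
  let ?B = "\<Union>n. B n"
  have diag: "diagonal_on ?f ?B"
    unfolding diagonal_on_def
  proof (intro conjI ballI impI)
    fix P Q assume "P \<in> ?B" "Q \<in> ?B" and ne: "P \<noteq> Q"
    then obtain n m where nm: "P \<in> B n" "Q \<in> B m" by blast
    consider "n < m" | "n = m" | "m < n" by linarith
    then show "L (P * Q) = 0"
    proof cases
      case 2
      then show ?thesis using B[of n] nm ne by (auto simp: diagonal_on_def)
    next
      case 3
      then show ?thesis using cross[OF nm(2,1)] by (simp add: mult.commute)
    qed (use cross nm in blast)
  next
    fix P assume "P \<in> ?B"
    then show "L (P * P) \<noteq> 0" using B by (auto simp: diagonal_on_def)
  qed
  let ?J = "SIGMA n:UNIV. {..<r N n}"
  have sp: "Real_Vector_Spaces.span ((\<lambda>(n, a). p n a) ` ?J) = Sym N"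
    using family_basis(2) * by (auto simp: basis_of_def)
  have "Real_Vector_Spaces.span ?B = Sym N"
  proof
    have "B n \<subseteq> Sym N" for n
    proof
      fix P assume "P \<in> B n"
      then obtain x where "P = comb n x" using B_comb by blast
      then show "P \<in> Sym N" using comb_Sym by simp
    qed
    then show "Real_Vector_Spaces.span ?B \<subseteq> Sym N"
      by (intro span_minimal subspace_Sym) blast
    have "p n a \<in> Real_Vector_Spaces.span ?B" if "a < r N n" for n a
    proof -
      have "p n a \<in> Real_Vector_Spaces.span (B n)" using that by (simp add: spanB span_base)
      then show ?thesis using span_mono[of "B n" ?B] by blast
    qed
    then show "Sym N \<subseteq> Real_Vector_Spaces.span ?B"
      unfolding sp[symmetric] by (intro span_minimal subspace_span) auto
  qed
  moreover have "Real_Vector_Spaces.independent ?B"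
    by (rule diagonal_independent[OF linear_L_mult_left diag])
  ultimately show ?thesis
    using diag unfolding quasi_definite_def basis_of_def diagonal_on_def power2_eq_square by blast
qed

end

section \<open>The recurrence relations\<close>

context graded_family
begin

text \<open>
  The recurrence for multiplication by an indeterminate, with the summation index \<open>j\<close> denoting
  the degree of the block: \<open>w_{m,i} p_n = \<Sum>_j T n m i j p_j\<close> with \<open>n - m \<le> j \<le> n + m\<close>. Truncated
  subtraction accounts for the absence of blocks of negative degree.
\<close>

definition recurrence :: "(nat \<Rightarrow> nat \<Rightarrow> nat \<Rightarrow> nat \<Rightarrow> nat \<Rightarrow> nat \<Rightarrow> real) \<Rightarrow> bool" where
  "recurrence T \<longleftrightarrow> (\<forall>n m i a. 1 \<le> m \<longrightarrow> i \<in> {1..N m} \<longrightarrow> a < r N n \<longrightarrow>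
     indet m i * p n a = (\<Sum>j\<in>{n - m..n + m}. comb j (T n m i j a)))"

text \<open>The stacked matrix \<open>A_n\<close> has trivial kernel, where \<open>A_{n,m,i} = T (n - m) m i n\<close>.\<close>

definition stack_A :: "(nat \<Rightarrow> nat \<Rightarrow> nat \<Rightarrow> nat \<Rightarrow> nat \<Rightarrow> nat \<Rightarrow> real) \<Rightarrow> nat \<Rightarrow> bool" where
  "stack_A T n \<longleftrightarrow> (\<forall>x. (\<forall>m\<in>{1..n}. \<forall>i\<in>{1..N m}. \<forall>a<r N (n - m).
        (\<Sum>b<r N n. T (n - m) m i n a b * x b) = 0) \<longrightarrow> (\<forall>b<r N n. x b = 0))"

text \<open>The stacked matrix \<open>C_n\<^sup>T\<close> has trivial kernel, where \<open>C_{n,m,i} = T n m i (n - m)\<close>.\<close>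

definition stack_C :: "(nat \<Rightarrow> nat \<Rightarrow> nat \<Rightarrow> nat \<Rightarrow> nat \<Rightarrow> nat \<Rightarrow> real) \<Rightarrow> nat \<Rightarrow> bool" where
  "stack_C T n \<longleftrightarrow> (\<forall>x. (\<forall>m\<in>{1..n}. \<forall>i\<in>{1..N m}. \<forall>b<r N (n - m).
        (\<Sum>a<r N n. T n m i (n - m) a b * x a) = 0) \<longrightarrow> (\<forall>a<r N n. x a = 0))"

lemma stack_AD:
  assumes "stack_A T n"
    and "\<And>m i a. m \<in> {1..n} \<Longrightarrow> i \<in> {1..N m} \<Longrightarrow> a < r N (n - m) \<Longrightarrow>
      (\<Sum>b<r N n. T (n - m) m i n a b * x b) = 0"
    and "b < r N n"
  shows "x b = 0"
  using assms unfolding stack_A_def by blast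

lemma stack_CD:
  assumes "stack_C T n"
    and "\<And>m i b. m \<in> {1..n} \<Longrightarrow> i \<in> {1..N m} \<Longrightarrow> b < r N (n - m) \<Longrightarrow>
      (\<Sum>a<r N n. T n m i (n - m) a b * x a) = 0"
    and "a < r N n"
  shows "x a = 0"
  using assms unfolding stack_C_def by blast

lemma recurrence_eq:
  "recurrence T \<Longrightarrow> 1 \<le> m \<Longrightarrow> i \<in> {1..N m} \<Longrightarrow> a < r N n \<Longrightarrow>
     indet m i * p n a = (\<Sum>j\<in>{n - m..n + m}. comb j (T n m i j a))"
  unfolding recurrence_def by blast

text \<open>
  Multiplication by \<open>w_{m,i}\<close> maps the monomials of degree \<open>n - m\<close> to monomials of degree \<open>n\<close>;
  \<open>shift n m i\<close> is this map on the positions in the enumeration.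
\<close>

definition shift :: "nat \<Rightarrow> nat \<Rightarrow> nat \<Rightarrow> nat \<Rightarrow> nat" where
  "shift n m i l = (SOME l'. l' < r N n \<and> e n l' = Poly_Mapping.single (m, i) 1 + e (n - m) l)"

lemma shift:
  assumes "m \<in> {1..n}" "i \<in> {1..N m}" "l < r N (n - m)"
  shows "shift n m i l < r N n" "e n (shift n m i l) = Poly_Mapping.single (m, i) 1 + e (n - m) l"
    "wmon n (shift n m i l) = indet m i * wmon (n - m) l"
proof -
  have "\<exists>l'. l' < r N n \<and> e n l' = Poly_Mapping.single (m, i) 1 + e (n - m) l"
    using indet_mult_wmon[OF assms] by metis
  from someI_ex[OF this]
  show "shift n m i l < r N n" "e n (shift n m i l) = Poly_Mapping.single (m, i) 1 + e (n - m) l"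
    unfolding shift_def by blast+
  then show "wmon n (shift n m i l) = indet m i * wmon (n - m) l"
    by (simp add: indet_def mult_single)
qed

lemma inj_on_shift:
  assumes "m \<in> {1..n}" "i \<in> {1..N m}"
  shows "inj_on (shift n m i) {..<r N (n - m)}"
proof (rule inj_onI)
  fix l k assume lk: "l \<in> {..<r N (n - m)}" "k \<in> {..<r N (n - m)}" "shift n m i l = shift n m i k"
  then have "e (n - m) l = e (n - m) k"
    using shift(2)[OF assms, of l] shift(2)[OF assms, of k] by simp
  then show "l = k" using lk e_inj by simp
qed

lemma shift_covers:
  assumes "1 \<le> n" "l < r N n"
  obtains m i l' where "m \<in> {1..n}" "i \<in> {1..N m}" "l' < r N (n - m)" "l = shift n m i l'"
proof -
  obtain m i l' where *: "m \<in> {1..n}" "i \<in> {1..N m}" "l' < r N (n - m)"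
    "e n l = Poly_Mapping.single (m, i) 1 + e (n - m) l'"
    using wmon_split[OF assms] by metis
  then have "l = shift n m i l'" using shift(1,2)[OF *(1-3)] assms(2) e_inj by metis
  then show thesis using that * by blast
qed

lemma lookup_indet_mult:
  assumes "m \<in> {1..n}" "i \<in> {1..N m}"
  shows "(\<Sum>l<r N n. Poly_Mapping.lookup (indet m i * P) (e n l) * y l) =
         (\<Sum>l<r N (n - m). Poly_Mapping.lookup P (e (n - m) l) * y (shift n m i l))"
proof -
  have "(\<Sum>l<r N n. Poly_Mapping.lookup (indet m i * P) (e n l) * y l) =
        (\<Sum>l\<in>shift n m i ` {..<r N (n - m)}. Poly_Mapping.lookup (indet m i * P) (e n l) * y l)"
  proof (rule sum.mono_neutral_right)
    show "\<forall>l\<in>{..<r N n} - shift n m i ` {..<r N (n - m)}.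
        Poly_Mapping.lookup (indet m i * P) (e n l) * y l = 0"
    proof
      fix l assume l: "l \<in> {..<r N n} - shift n m i ` {..<r N (n - m)}"
      have "e n l \<notin> Poly_Mapping.keys (indet m i * P)"
      proof
        assume "e n l \<in> Poly_Mapping.keys (indet m i * P)"
        then obtain \<beta> where eq: "e n l = Poly_Mapping.single (m, i) 1 + \<beta>"
          unfolding indet_def keys_single_mult by blast
        have "\<beta> \<in> exponents N (n - m)"
          using e_exponents[of l n] l by (auto simp: eq exponents_def tdeg_add keys_add_nat)
        then obtain l' where l': "l' < r N (n - m)" "\<beta> = e (n - m) l'" using e_surj by blast
        then have "e n l = e n (shift n m i l')" using shift(2)[OF assms l'(1)] eq by simp
        then have "l = shift n m i l'" using e_inj shift(1)[OF assms l'(1)] l by auto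
        then show False using l l' by auto
      qed
      then show "Poly_Mapping.lookup (indet m i * P) (e n l) * y l = 0" by (simp add: in_keys_iff)
    qed
  qed (use shift(1)[OF assms] in auto)
  also have "\<dots> = (\<Sum>l<r N (n - m). Poly_Mapping.lookup P (e (n - m) l) * y (shift n m i l))"
    using shift(2)[OF assms] inj_on_shift[OF assms]
    by (simp add: sum.reindex indet_def)
  finally show ?thesis .
qed

text \<open>The leading coefficients in the recurrence: \<open>A_{n,m,i} G_n = G_{n-m} S\<close>, \<open>S\<close> the shift.\<close>

lemma lookup_recurrence_top:
  assumes rec: "recurrence T" and deg: "\<And>j. j < n \<Longrightarrow> deg_bound j"
    and m: "m \<in> {1..n}" "i \<in> {1..N m}" and a: "a < r N (n - m)" and l: "l < r N n"
  shows "Poly_Mapping.lookup (indet m i * p (n - m) a) (e n l) =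
         (\<Sum>b<r N n. T (n - m) m i n a b * Poly_Mapping.lookup (p n b) (e n l))"
proof -
  let ?c = "\<lambda>j. Poly_Mapping.lookup (comb j (T (n - m) m i j a)) (e n l)"
  have "Poly_Mapping.lookup (indet m i * p (n - m) a) (e n l) = (\<Sum>j\<in>{n - m - m..n}. ?c j)"
    using recurrence_eq[OF rec _ m(2) a] m(1) by (simp add: lookup_sum)
  also have "\<dots> = (\<Sum>j\<in>{n}. ?c j)"
  proof (rule sum.mono_neutral_right)
    show "\<forall>j\<in>{n - m - m..n} - {n}. ?c j = 0"
      using deg comb_Sym_less lookup_Sym_less l by (metis Diff_iff Suc_leI atLeastAtMost_iff le_neq_implies_less singletonI)
  qed auto
  finally show ?thesis by (simp add: lookup_comb mult.commute)
qed

lemma sum_recurrence_top: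
  assumes "recurrence T" "\<And>j. j < n \<Longrightarrow> deg_bound j"
    and m: "m \<in> {1..n}" "i \<in> {1..N m}" and "a < r N (n - m)"
  shows "(\<Sum>b<r N n. T (n - m) m i n a b * (\<Sum>l<r N n. Poly_Mapping.lookup (p n b) (e n l) * y l)) =
         (\<Sum>l<r N (n - m). Poly_Mapping.lookup (p (n - m) a) (e (n - m) l) * y (shift n m i l))"
proof -
  have "(\<Sum>b<r N n. T (n - m) m i n a b * (\<Sum>l<r N n. Poly_Mapping.lookup (p n b) (e n l) * y l)) =
        (\<Sum>b<r N n. \<Sum>l<r N n. T (n - m) m i n a b * Poly_Mapping.lookup (p n b) (e n l) * y l)"
    by (simp add: sum_distrib_left mult.assoc)
  also have "\<dots> =
        (\<Sum>l<r N n. (\<Sum>b<r N n. T (n - m) m i n a b * Poly_Mapping.lookup (p n b) (e n l)) * y l)"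
    by (subst sum.swap) (simp add: sum_distrib_right)
  also have "\<dots> = (\<Sum>l<r N n. Poly_Mapping.lookup (indet m i * p (n - m) a) (e n l) * y l)"
    using lookup_recurrence_top[OF assms] by simp
  finally show ?thesis using lookup_indet_mult[OF m] by simp
qed

lemma shift_coeffs_zero:
  assumes "1 \<le> n" "\<And>j. j < n \<Longrightarrow> lead j"
    and zero: "\<And>m i a. m \<in> {1..n} \<Longrightarrow> i \<in> {1..N m} \<Longrightarrow> a < r N (n - m) \<Longrightarrow>
      (\<Sum>l<r N (n - m). Poly_Mapping.lookup (p (n - m) a) (e (n - m) l) * y (shift n m i l)) = 0"
    and "l < r N n"
  shows "y l = 0"
proof -
  obtain m i l' where m: "m \<in> {1..n}" "i \<in> {1..N m}" and l': "l' < r N (n - m)" "l = shift n m i l'"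
    using shift_covers[OF assms(1,4)] by blast
  have "lead (n - m)" using assms(1,2) m by auto
  then have "y (shift n m i l') = 0"
    unfolding lead_def using zero[OF m] l'(1) by (rule nondegD)
  then show ?thesis using l' by simp
qed

text \<open>
  A vector \<open>x = G_n y\<close> in the kernel of the stacked matrix satisfies \<open>G_{n-m} S y = 0\<close> for every
  \<open>m\<close> and \<open>i\<close>; hence \<open>S y = 0\<close>, and the vectors \<open>S y\<close> comprise all components of \<open>y\<close>.
\<close>

lemma stack_A_of_lead:
  assumes rec: "recurrence T" and dl: "\<And>n. deg_bound n \<and> lead n" and n: "1 \<le> n"
  shows "stack_A T n"
  unfolding stack_A_def
proof (intro allI impI)
  fix x b
  assume x: "\<forall>m\<in>{1..n}. \<forall>i\<in>{1..N m}. \<forall>a<r N (n - m). (\<Sum>b<r N n. T (n - m) m i n a b * x b) = 0"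
    and b: "b < r N n"
  obtain y where y: "\<And>b. b < r N n \<Longrightarrow> (\<Sum>l<r N n. Poly_Mapping.lookup (p n b) (e n l) * y l) = x b"
    using nondeg_solvable[of "r N n" "\<lambda>b l. Poly_Mapping.lookup (p n b) (e n l)" x] dl lead_def by blast
  have "y l = 0" if "l < r N n" for l
  proof (rule shift_coeffs_zero[OF n _ _ that])
    fix m i a assume mi: "m \<in> {1..n}" "i \<in> {1..N m}" "a < r N (n - m)"
    have "(\<Sum>l<r N (n - m). Poly_Mapping.lookup (p (n - m) a) (e (n - m) l) * y (shift n m i l)) =
          (\<Sum>b<r N n. T (n - m) m i n a b * x b)"
      using sum_recurrence_top[OF rec _ mi, of y] dl y by simp
    then show "(\<Sum>l<r N (n - m). Poly_Mapping.lookup (p (n - m) a) (e (n - m) l) * y (shift n m i l)) = 0"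
      using x mi by simp
  qed (use dl in blast)
  then show "x b = 0" using y[OF b] by simp
qed

text \<open>The same argument propagates the nondegeneracy of the leading coefficients to degree \<open>n\<close>.\<close>

lemma lead_step:
  assumes rec: "recurrence T" and deg: "\<And>n. deg_bound n" and n: "1 \<le> n"
    and lead: "\<And>j. j < n \<Longrightarrow> lead j"
  shows "lead n"
  unfolding lead_def nondeg_def
proof (intro allI impI)
  fix y l
  assume y: "\<forall>b<r N n. (\<Sum>l<r N n. Poly_Mapping.lookup (p n b) (e n l) * y l) = 0"
    and l: "l < r N n"
  show "y l = 0"
  proof (rule shift_coeffs_zero[OF n lead _ l])
    fix m i a assume mi: "m \<in> {1..n}" "i \<in> {1..N m}" "a < r N (n - m)"
    show "(\<Sum>l<r N (n - m). Poly_Mapping.lookup (p (n - m) a) (e (n - m) l) * y (shift n m i l)) = 0"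
      using sum_recurrence_top[OF rec deg mi, of y] y by simp
  qed
qed

text \<open>The rows of \<open>A_{n,m,i}\<close> are independent.\<close>

lemma rows_A:
  assumes rec: "recurrence T" and dl: "\<And>n. deg_bound n \<and> lead n"
    and m: "m \<in> {1..n}" "i \<in> {1..N m}"
    and x: "\<And>b. b < r N n \<Longrightarrow> (\<Sum>a<r N (n - m). x a * T (n - m) m i n a b) = 0"
    and a: "a < r N (n - m)"
  shows "x a = 0"
proof (rule nondegD[OF _ _ a])
  show "nondeg (r N (n - m)) (\<lambda>l a. Poly_Mapping.lookup (p (n - m) a) (e (n - m) l))"
    using dl lead_transpose by blast
  fix l assume l: "l < r N (n - m)"
  let ?l = "shift n m i l"
  have sh: "?l < r N n" using shift(1)[OF m l] .
  have "(\<Sum>a<r N (n - m). Poly_Mapping.lookup (p (n - m) a) (e (n - m) l) * x a) =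
        (\<Sum>a<r N (n - m). Poly_Mapping.lookup (indet m i * p (n - m) a) (e n ?l) * x a)"
    using shift(2)[OF m l] by (simp add: indet_def)
  also have "\<dots> = (\<Sum>a<r N (n - m).
      (\<Sum>b<r N n. T (n - m) m i n a b * Poly_Mapping.lookup (p n b) (e n ?l)) * x a)"
    using lookup_recurrence_top[OF rec _ m _ sh] dl by simp
  also have "\<dots> = (\<Sum>a<r N (n - m). \<Sum>b<r N n.
      x a * T (n - m) m i n a b * Poly_Mapping.lookup (p n b) (e n ?l))"
    by (simp add: sum_distrib_left mult_ac)
  also have "\<dots> = (\<Sum>b<r N n. (\<Sum>a<r N (n - m). x a * T (n - m) m i n a b) *
      Poly_Mapping.lookup (p n b) (e n ?l))"
    by (subst sum.swap) (simp add: sum_distrib_right)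
  finally show "(\<Sum>a<r N (n - m). Poly_Mapping.lookup (p (n - m) a) (e (n - m) l) * x a) = 0"
    using x by simp
qed

text \<open>
  A coefficient of \<open>p_n\<close> in degree above \<open>n\<close> is annihilated by all the \<open>A_{n,m,i}\<close>, because the
  other terms of the recurrence have total degree at most \<open>n\<close>.
\<close>

lemma deg_bound_of_recurrence:
  assumes rec: "recurrence T" and stack: "\<And>n. 1 \<le> n \<Longrightarrow> stack_A T n" and "deg_bound 0"
  shows "deg_bound n"
proof (induction n rule: less_induct)
  case (less n)
  show ?case
  proof (cases "n = 0")
    case False
    have zero: "Poly_Mapping.lookup (p n b) \<alpha> = 0" if \<alpha>: "\<not> tdeg \<alpha> < Suc n" and b: "b < r N n" for \<alpha> b
    proof -
      have "(\<Sum>b<r N n. T (n - m) m i n a b * Poly_Mapping.lookup (p n b) \<alpha>) = 0"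
        if mi: "m \<in> {1..n}" "i \<in> {1..N m}" "a < r N (n - m)" for m i a
      proof -
        let ?c = "\<lambda>j. Poly_Mapping.lookup (comb j (T (n - m) m i j a)) \<alpha>"
        have "p (n - m) a \<in> Sym_less N (Suc (n - m))"
          using less[of "n - m"] mi by (auto simp: deg_bound_def)
        then have "indet m i * p (n - m) a \<in> Sym_less N (m + Suc (n - m))"
          using mi by (intro indet_mult_Sym_less) auto
        then have "Poly_Mapping.lookup (indet m i * p (n - m) a) \<alpha> = 0"
          using \<alpha> mi by (auto simp: Sym_less_iff)
        moreover have "Poly_Mapping.lookup (indet m i * p (n - m) a) \<alpha> = (\<Sum>j\<in>{n - m - m..n}. ?c j)"
          using recurrence_eq[OF rec _ mi(2,3)] mi(1) by (simp add: lookup_sum)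
        moreover have "(\<Sum>j\<in>{n - m - m..n}. ?c j) = (\<Sum>j\<in>{n}. ?c j)"
        proof (rule sum.mono_neutral_right)
          show "\<forall>j\<in>{n - m - m..n} - {n}. ?c j = 0"
          proof
            fix j assume "j \<in> {n - m - m..n} - {n}"
            then have j: "j < n" by auto
            then have "comb j (T (n - m) m i j a) \<in> Sym_less N (Suc j)"
              using less comb_Sym_less by blast
            then show "?c j = 0" using \<alpha> j by (force simp: Sym_less_iff)
          qed
        qed auto
        ultimately show ?thesis by (simp add: lookup_comb mult.commute)
      qed
      then show ?thesis
        using False b by (intro stack_AD[OF stack, of n "\<lambda>b. Poly_Mapping.lookup (p n b) \<alpha>"]) auto
    qed
    then show ?thesis using p_Sym unfolding deg_bound_def Sym_less_iff Sym_iff by blast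
  qed (simp add: assms)
qed

end

context graded_functional
begin

text \<open>Block orthogonality truncates the expansion of \<open>w_{m,i} p_n\<close> from below.\<close>

lemma recurrence_exists:
  assumes *: "\<And>n. deg_bound n \<and> lead n \<and> orth n \<and> pairing n"
  shows "\<exists>T. recurrence T"
proof -
  have ex: "\<exists>X. indet m i * p n a = (\<Sum>j\<in>{n - m..n + m}. comb j (X j))"
    if mi: "1 \<le> m" "i \<in> {1..N m}" "a < r N n" for n m i a
  proof -
    let ?P = "indet m i * p n a"
    have "?P \<in> Sym_less N (m + Suc n)"
      using mi * by (intro indet_mult_Sym_less) (auto simp: deg_bound_def)
    then obtain X where X: "?P = (\<Sum>j<m + Suc n. comb j (X j))"
      using expand_Sym_less * by blast
    have "X j b = 0" if j: "j < n - m" "b < r N j" for j b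
    proof (rule triangular[OF _ X _ _ j])
      fix j l assume jl: "j < n - m" "l < r N j"
      have "wmon j l * indet m i \<in> Sym_less N (m + Suc j)"
        using indet_mult_Sym_less[OF mi(1,2) wmon_Sym_less[OF jl(2)]] by (subst mult.commute)
      then have "wmon j l * indet m i \<in> Sym_less N n"
        using Sym_less_mono[of "m + Suc j" n N] jl(1) by (simp add: subset_iff)
      then have "L (wmon j l * indet m i * p n a) = 0"
        using lower_orth * p_eq_comb[OF mi(3)] by metis
      then show "L (wmon j l * (indet m i * p n a)) = 0" by (simp add: mult.assoc)
    qed (use * in auto)
    then have "?P = (\<Sum>j\<in>{n - m..n + m}. comb j (X j))"
      unfolding X by (intro sum.mono_neutral_right) (auto intro: comb_zero)
    then show ?thesis by blast
  qed
  then have "recurrence (\<lambda>n m i j a.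
      (SOME X. indet m i * p n a = (\<Sum>j\<in>{n - m..n + m}. comb j (X j))) j)"
    unfolding recurrence_def using someI_ex[OF ex] by simp
  then show ?thesis by blast
qed

text \<open>Pairing the recurrence with \<open>w_{n-m}\<close> leaves only the lowest term.\<close>

lemma pairing_recurrence:
  assumes rec: "recurrence T" and orth: "\<And>n. orth n"
    and m: "m \<in> {1..n}" "i \<in> {1..N m}" and a: "a < r N n" and l: "l < r N (n - m)"
  shows "L (wmon n (shift n m i l) * p n a) =
         (\<Sum>b<r N (n - m). L (wmon (n - m) l * p (n - m) b) * T n m i (n - m) a b)"
proof -
  let ?c = "\<lambda>j. L (wmon (n - m) l * comb j (T n m i j a))"
  have "L (wmon n (shift n m i l) * p n a) = L (wmon (n - m) l * (indet m i * p n a))"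
    using shift(3)[OF m l] by (simp add: mult_ac)
  also have "\<dots> = (\<Sum>j\<in>{n - m..n + m}. ?c j)"
    using recurrence_eq[OF rec _ m(2) a] m(1) by (simp add: sum_distrib_left linear_sum[OF linear_L])
  also have "\<dots> = (\<Sum>j\<in>{n - m}. ?c j)"
    using orth l by (intro sum.mono_neutral_right) (auto intro!: wmon_comb_orth)
  finally show ?thesis by (simp add: linear_mult_comb[OF linear_L])
qed

lemma pairing_recurrence_comb:
  assumes "recurrence T" "\<And>n. orth n" "m \<in> {1..n}" "i \<in> {1..N m}" "l < r N (n - m)"
  shows "(\<Sum>a<r N n. L (wmon n (shift n m i l) * p n a) * x a) =
    (\<Sum>b<r N (n - m). L (wmon (n - m) l * p (n - m) b) * (\<Sum>a<r N n. T n m i (n - m) a b * x a))"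
proof -
  have "(\<Sum>a<r N n. L (wmon n (shift n m i l) * p n a) * x a) =
    (\<Sum>a<r N n. \<Sum>b<r N (n - m). L (wmon (n - m) l * p (n - m) b) * T n m i (n - m) a b * x a)"
    using pairing_recurrence[OF assms(1-4) _ assms(5)] by (simp add: sum_distrib_right)
  also have "\<dots> =
    (\<Sum>b<r N (n - m). \<Sum>a<r N n. L (wmon (n - m) l * p (n - m) b) * T n m i (n - m) a b * x a)"
    by (rule sum.swap)
  finally show ?thesis by (simp add: sum_distrib_left mult.assoc)
qed

lemma stack_C_of_pairing:
  assumes rec: "recurrence T" and orth: "\<And>n. orth n" and "pairing n" and n: "1 \<le> n"
  shows "stack_C T n"
  unfolding stack_C_def
proof (intro allI impI)
  fix x a
  assume x: "\<forall>m\<in>{1..n}. \<forall>i\<in>{1..N m}. \<forall>b<r N (n - m). (\<Sum>a<r N n. T n m i (n - m) a b * x a) = 0"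
    and a: "a < r N n"
  show "x a = 0"
  proof (rule nondegD[OF assms(3)[unfolded pairing_def] _ a])
    fix l assume "l < r N n"
    then obtain m i l' where mi: "m \<in> {1..n}" "i \<in> {1..N m}" "l' < r N (n - m)" "l = shift n m i l'"
      using shift_covers[OF n] by blast
    then show "(\<Sum>a<r N n. L (wmon n l * p n a) * x a) = 0"
      using pairing_recurrence_comb[OF rec orth mi(1-3)] x by simp
  qed
qed

text \<open>
  Conversely, the identity \<open>S H_n = H_{n-m} C_{n,m,i}\<^sup>T\<close> for \<open>H_n = (w_n, p_n\<^sup>T)\<close> propagates
  nondegeneracy to degree \<open>n\<close>.
\<close>

lemma pairing_step:
  assumes rec: "recurrence T" and orth: "\<And>n. orth n" and stack: "stack_C T n"
    and pair: "\<And>j. j < n \<Longrightarrow> pairing j"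
  shows "pairing n"
  unfolding pairing_def nondeg_def
proof (intro allI impI)
  fix x a
  assume x: "\<forall>l<r N n. (\<Sum>b<r N n. L (wmon n l * p n b) * x b) = 0" and a: "a < r N n"
  have "(\<Sum>a<r N n. T n m i (n - m) a b * x a) = 0"
    if mi: "m \<in> {1..n}" "i \<in> {1..N m}" and b: "b < r N (n - m)" for m i b
  proof (rule nondegD[OF _ _ b, where x = "\<lambda>b. \<Sum>a<r N n. T n m i (n - m) a b * x a"])
    show "nondeg (r N (n - m)) (\<lambda>l b. L (wmon (n - m) l * p (n - m) b))"
      using pair[of "n - m"] mi by (auto simp: pairing_def)
    show "(\<Sum>b<r N (n - m). L (wmon (n - m) l * p (n - m) b) *
        (\<Sum>a<r N n. T n m i (n - m) a b * x a)) = 0" if l: "l < r N (n - m)" for l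
      using pairing_recurrence_comb[OF rec orth mi l, of x] x shift(1)[OF mi l] by simp
  qed
  then show "x a = 0" by (rule stack_CD[OF stack _ a])
qed

text \<open>The columns of \<open>C_{n,m,i}\<close> are independent.\<close>

lemma columns_C:
  assumes rec: "recurrence T" and orth: "\<And>n. orth n" and pair: "\<And>n. pairing n"
    and m: "m \<in> {1..n}" "i \<in> {1..N m}"
    and x: "\<And>a. a < r N n \<Longrightarrow> (\<Sum>b<r N (n - m). T n m i (n - m) a b * x b) = 0"
    and b: "b < r N (n - m)"
  shows "x b = 0"
proof -
  let ?H = "\<lambda>k l b. L (wmon k l * p k b)"
  have nd: "nondeg (r N k) (\<lambda>b l. ?H k l b)" for k
    using pair[of k] nondeg_transpose[of "r N k" "?H k"] by (simp add: pairing_def)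
  obtain y where y: "\<And>b. b < r N (n - m) \<Longrightarrow> (\<Sum>l<r N (n - m). ?H (n - m) l b * y l) = x b"
    using nondeg_solvable[OF nd[of "n - m"], of x] by blast
  \<comment> \<open>Extend the coefficient vector \<open>y\<close> of a polynomial of degree \<open>n - m\<close> to that of its product with \<open>w_{m,i}\<close>.\<close>
  define z where "z l' = (\<Sum>l<r N (n - m). if shift n m i l = l' then y l else 0)" for l'
  have "(\<Sum>l'<r N n. ?H n l' a * z l') = 0" if a: "a < r N n" for a
  proof -
    have "(\<Sum>l'<r N n. ?H n l' a * z l') =
      (\<Sum>l'<r N n. \<Sum>l<r N (n - m). if shift n m i l = l' then ?H n l' a * y l else 0)"
      by (simp add: z_def sum_distrib_left if_distrib cong: if_cong)
    also have "\<dots> = (\<Sum>l<r N (n - m). \<Sum>l'<r N n. if shift n m i l = l' then ?H n l' a * y l else 0)"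
      by (rule sum.swap)
    also have "\<dots> = (\<Sum>l<r N (n - m). ?H n (shift n m i l) a * y l)"
      using shift(1)[OF m] by (simp add: sum.delta)
    also have "\<dots> = (\<Sum>l<r N (n - m). \<Sum>b<r N (n - m). ?H (n - m) l b * T n m i (n - m) a b * y l)"
      using pairing_recurrence[OF rec orth m a] by (simp add: sum_distrib_right)
    also have "\<dots> = (\<Sum>b<r N (n - m). \<Sum>l<r N (n - m). ?H (n - m) l b * T n m i (n - m) a b * y l)"
      by (rule sum.swap)
    also have "\<dots> = (\<Sum>b<r N (n - m). T n m i (n - m) a b * (\<Sum>l<r N (n - m). ?H (n - m) l b * y l))"
      by (simp add: sum_distrib_left mult_ac)
    also have "\<dots> = 0" using x[OF a] y by simp
    finally show ?thesis .
  qed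
  then have z: "z l' = 0" if "l' < r N n" for l'
    using nondegD[OF nd[of n] _ that, of z] by blast
  have "y l = 0" if l: "l < r N (n - m)" for l
  proof -
    have "z (shift n m i l) = (\<Sum>k<r N (n - m). if k = l then y k else 0)"
      unfolding z_def using inj_on_shift[OF m] l
      by (intro sum.cong) (auto simp: inj_on_def)
    also have "\<dots> = y l" using l by (simp add: sum.delta)
    finally show ?thesis using z shift(1)[OF m l] by simp
  qed
  then show ?thesis using y[OF b] by simp
qed

text \<open>
  If \<open>L\<close> annihilates all entries of positive degree then block orthogonality follows from the
  recurrence by moving the indeterminates of a monomial, one at a time, to the other factor.
\<close>

lemma orth_of_recurrence:
  assumes rec: "recurrence T" and L: "\<And>n a. 1 \<le> n \<Longrightarrow> a < r N n \<Longrightarrow> L (p n a) = 0"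
  shows "orth n"
proof -
  have "L (wmon m l * p n a) = 0" if "m < n" "l < r N m" "a < r N n" for m n l a
    using that
  proof (induction m arbitrary: n l a rule: less_induct)
    case (less m)
    show ?case
    proof (cases "m = 0")
      case True
      then show ?thesis using less.prems wmon_0[of l] L by auto
    next
      case False
      then obtain j i l' where ji: "j \<in> {1..m}" "i \<in> {1..N j}" and l': "l' < r N (m - j)"
        and eq: "wmon m l = indet j i * wmon (m - j) l'"
        using wmon_split[of m l] less.prems by (metis One_nat_def Suc_leI neq0_conv)
      have "L (wmon m l * p n a) = L (wmon (m - j) l' * (indet j i * p n a))"
        by (simp add: eq mult_ac)
      also have "\<dots> = (\<Sum>k\<in>{n - j..n + j}. L (wmon (m - j) l' * comb k (T n j i k a)))"
        using recurrence_eq[OF rec _ ji(2) less.prems(3)] ji(1)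
        by (simp add: sum_distrib_left linear_sum[OF linear_L])
      also have "\<dots> = 0"
      proof (intro sum.neutral ballI)
        fix k assume "k \<in> {n - j..n + j}"
        then have "m - j < k" using ji less.prems(1) by auto
        then show "L (wmon (m - j) l' * comb k (T n j i k a)) = 0"
          using less.IH[of "m - j"] ji l' by (auto simp: linear_mult_comb[OF linear_L])
      qed
      finally show ?thesis .
    qed
  qed
  then show ?thesis by (simp add: orth_def)
qed

end

section \<open>The matrices of the recurrence and the equivalence\<close>

text \<open>
  The sum over \<open>-m \<le> k \<le> m\<close> becomes a sum over the degree \<open>j = n - m + k\<close>; the terms of negative
  degree vanish because their polynomial vector is empty.
\<close>

lemma (in graded_family) sum_p_int:
  fixes q :: "nat \<Rightarrow> sympoly vec"
  assumes q: "\<And>n. dim_vec (q n) = r N n" "\<And>n a. q n $ a = p n a"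
    and m: "m \<le> n" and a: "a < r N (n - m)"
    and M: "\<And>k. k \<in> {- int m..int m} \<Longrightarrow> dim_row (M k) = r N (n - m)"
  shows "(\<Sum>k\<in>{- int m..int m}. mat_poly_vec (M k) (p_int q (int n - int m + k)) $ a) =
         (\<Sum>j\<in>{n - m - m..n}. comb j (\<lambda>b. M (int j - int (n - m)) $$ (a, b)))"
proof -
  let ?f = "\<lambda>k. mat_poly_vec (M k) (p_int q (int n - int m + k)) $ a"
  have "(\<Sum>k\<in>{- int m..int m}. ?f k) =
        (\<Sum>k\<in>(\<lambda>j. int j - int (n - m)) ` {n - m - m..n}. ?f k)"
  proof (rule sum.mono_neutral_right)
    show "\<forall>k\<in>{- int m..int m} - (\<lambda>j. int j - int (n - m)) ` {n - m - m..n}. ?f k = 0"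
    proof
      fix k assume k: "k \<in> {- int m..int m} - (\<lambda>j. int j - int (n - m)) ` {n - m - m..n}"
      have "int n - int m + k < 0"
      proof (rule ccontr)
        assume nn: "\<not> int n - int m + k < 0"
        then have "k = int (nat (int n - int m + k)) - int (n - m)" using m by simp
        moreover have "nat (int n - int m + k) \<in> {n - m - m..n}" using k nn m by auto
        ultimately show False using k by blast
      qed
      then show "?f k = 0" using a M k by (simp add: p_int_def mat_poly_vec_def)
    qed
  qed (use m in auto)
  also have "\<dots> = (\<Sum>j\<in>{n - m - m..n}. ?f (int j - int (n - m)))"
    by (subst sum.reindex) (auto simp: inj_on_def)
  also have "\<dots> = (\<Sum>j\<in>{n - m - m..n}. comb j (\<lambda>b. M (int j - int (n - m)) $$ (a, b)))"
  proof (intro sum.cong refl)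
    fix j assume "j \<in> {n - m - m..n}"
    then have "int j - int (n - m) \<in> {- int m..int m}" "int n - int m + (int j - int (n - m)) = int j"
      using m by auto
    then show "?f (int j - int (n - m)) = comb j (\<lambda>b. M (int j - int (n - m)) $$ (a, b))"
      using a M by (simp add: mat_poly_vec_def p_int_def comb_def q)
  qed
  finally show ?thesis .
qed

text \<open>
  Matrices \<open>M\<close> of the required formats, with the same entries as the coefficients \<open>T\<close>:
  the array \<open>T n m i j\<close> is the matrix \<open>M (j - n) (n + m) m i\<close>. The vectors \<open>q n\<close> list the family \<open>p n\<close>.
\<close>

locale matrix_recurrence = graded_family +
  fixes q :: "nat \<Rightarrow> sympoly vec"
    and M :: "int \<Rightarrow> nat \<Rightarrow> nat \<Rightarrow> nat \<Rightarrow> real mat"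
    and T :: "nat \<Rightarrow> nat \<Rightarrow> nat \<Rightarrow> nat \<Rightarrow> nat \<Rightarrow> nat \<Rightarrow> real"
  assumes q: "dim_vec (q n) = r N n" "q n $ a = p n a"
    and M_carrier: "m \<in> {1..n} \<Longrightarrow> i \<in> {1..N m} \<Longrightarrow> k \<in> {- int m..int m} \<Longrightarrow>
      M k n m i \<in> carrier_mat (r N (n - m)) (r_int N (int n - int m + k))"
    and M_entry: "m \<in> {1..n} \<Longrightarrow> i \<in> {1..N m} \<Longrightarrow> j \<in> {n - m - m..n} \<Longrightarrow> a < r N (n - m) \<Longrightarrow>
      b < r N j \<Longrightarrow> M (int j - int (n - m)) n m i $$ (a, b) = T (n - m) m i j a b"
begin

lemma sum_M:
  assumes "m \<in> {1..n}" "i \<in> {1..N m}" "a < r N (n - m)"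
  shows "(\<Sum>k\<in>{- int m..int m}. mat_poly_vec (M k n m i) (p_int q (int n - int m + k)) $ a) =
         (\<Sum>j\<in>{n - m - m..n}. comb j (T (n - m) m i j a))"
proof -
  have "(\<Sum>k\<in>{- int m..int m}. mat_poly_vec (M k n m i) (p_int q (int n - int m + k)) $ a) =
        (\<Sum>j\<in>{n - m - m..n}. comb j (\<lambda>b. M (int j - int (n - m)) n m i $$ (a, b)))"
    using assms carrier_matD(1)[OF M_carrier[OF assms(1,2)]] by (intro sum_p_int q) auto
  also have "\<dots> = (\<Sum>j\<in>{n - m - m..n}. comb j (T (n - m) m i j a))"
    using M_entry assms by (intro sum.cong refl comb_cong) auto
  finally show ?thesis .
qed

lemma recurrence_iff:
  "recurrence T \<longleftrightarrow>
     (\<forall>n. \<forall>m\<in>{1..n}. \<forall>i\<in>{1..N m}. \<forall>a<r N (n - m). indet m i * q (n - m) $ a =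
        (\<Sum>k\<in>{- int m..int m}. mat_poly_vec (M k n m i) (p_int q (int n - int m + k)) $ a))"
proof -
  have "recurrence T \<longleftrightarrow> (\<forall>n. \<forall>m\<in>{1..n}. \<forall>i\<in>{1..N m}. \<forall>a<r N (n - m). indet m i * p (n - m) a =
        (\<Sum>j\<in>{n - m - m..n}. comb j (T (n - m) m i j a)))" (is "_ \<longleftrightarrow> ?R")
  proof
    assume rec: "recurrence T"
    show ?R using recurrence_eq[OF rec] by simp
  next
    assume R: ?R
    show "recurrence T"
      unfolding recurrence_def
    proof (intro allI impI)
      fix n m i a assume "1 \<le> m" "i \<in> {1..N m}" "a < r N n"
      then show "indet m i * p n a = (\<Sum>j\<in>{n - m..n + m}. comb j (T n m i j a))"
        using R[rule_format, of m "n + m" i a] by simp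
    qed
  qed
  also have "\<dots> \<longleftrightarrow> (\<forall>n. \<forall>m\<in>{1..n}. \<forall>i\<in>{1..N m}. \<forall>a<r N (n - m). indet m i * q (n - m) $ a =
        (\<Sum>k\<in>{- int m..int m}. mat_poly_vec (M k n m i) (p_int q (int n - int m + k)) $ a))"
    using sum_M by (simp add: q)
  finally show ?thesis .
qed

lemma A_carrier: "m \<in> {1..n} \<Longrightarrow> i \<in> {1..N m} \<Longrightarrow> M (int m) n m i \<in> carrier_mat (r N (n - m)) (r N n)"
  using M_carrier[of m n i "int m"] by (simp add: r_int_def)

lemma A_entry: "m \<in> {1..n} \<Longrightarrow> i \<in> {1..N m} \<Longrightarrow> a < r N (n - m) \<Longrightarrow> b < r N n \<Longrightarrow>
    M (int m) n m i $$ (a, b) = T (n - m) m i n a b"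
  using M_entry[of m n i n a b] by simp

lemma C_carrier:
  assumes m: "m \<in> {1..n}" "i \<in> {1..N m}"
  shows "M (- int m) (n + m) m i \<in> carrier_mat (r N n) (r N (n - m))"
proof -
  have "M (- int m) (n + m) m i \<in>
      carrier_mat (r N (n + m - m)) (r_int N (int (n + m) - int m + - int m))"
    using m by (intro M_carrier) auto
  moreover have eq: "int (n + m) - int m + - int m = int (n - m)" using m by simp
  have "r_int N (int (n + m) - int m + - int m) = r N (n - m)"
    unfolding eq r_int_def by simp
  ultimately show ?thesis by simp
qed

lemma C_entry: "m \<in> {1..n} \<Longrightarrow> i \<in> {1..N m} \<Longrightarrow> a < r N n \<Longrightarrow> b < r N (n - m) \<Longrightarrow>
    M (- int m) (n + m) m i $$ (a, b) = T n m i (n - m) a b"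
  using M_entry[of m "n + m" i "n - m" a b] by simp

lemma mrank_stack_A:
  "mrank (stack N (r N n) n (\<lambda>m i. M (int m) n m i)) = r N n \<longleftrightarrow> stack_A T n"
  by (subst mrank_stack_iff[of n N _ "\<lambda>m. r N (n - m)"])
    (auto simp: stack_A_def A_entry intro: A_carrier)

lemma mrank_stack_C:
  "mrank (stack N (r N n) n (\<lambda>m i. transpose_mat (M (- int m) (n + m) m i))) = r N n \<longleftrightarrow> stack_C T n"
proof -
  have "transpose_mat (M (- int m) (n + m) m i) $$ (b, a) = T n m i (n - m) a b"
    if "m \<in> {1..n}" "i \<in> {1..N m}" "a < r N n" "b < r N (n - m)" for m i a b
    using C_carrier[OF that(1,2)] C_entry[OF that] that by auto
  then show ?thesis
    by (subst mrank_stack_iff[of n N _ "\<lambda>m. r N (n - m)"])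
      (auto simp: stack_C_def intro: C_carrier)
qed

lemma mrank_A:
  assumes "recurrence T" "\<And>n. deg_bound n \<and> lead n" and m: "m \<in> {1..n}" "i \<in> {1..N m}"
  shows "mrank (M (int m) n m i) = r N (n - m)"
proof (rule mrank_eq_rowsI[OF A_carrier[OF m]])
  fix x assume x: "\<And>b. b < r N n \<Longrightarrow> (\<Sum>a<r N (n - m). x a * M (int m) n m i $$ (a, b)) = 0"
  have "(\<Sum>a<r N (n - m). x a * T (n - m) m i n a b) = 0" if "b < r N n" for b
    using x[OF that] A_entry[OF m _ that] by simp
  then show "\<forall>a<r N (n - m). x a = 0" using rows_A[OF assms] by blast
qed

end

lemma monomial_vectors_enumeration:
  assumes "monomial_vectors N w"
  obtains e where "\<And>n. bij_betw (e n) {..<r N n} (exponents N n)"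
    "\<And>n l. l < r N n \<Longrightarrow> w n $ l = Poly_Mapping.single (e n l) 1"
proof -
  let ?s = "\<lambda>\<alpha>::exponent. Poly_Mapping.single \<alpha> (1::real)"
  define e where "e n l = inv_into (exponents N n) ?s (w n $ l)" for n l
  have inj: "inj_on ?s (exponents N n)" for n
    by (rule inj_onI) (metis keys_single the_elem_eq zero_neq_one)
  have w: "bij_betw (vec_index (w n)) {..<r N n} (?s ` exponents N n)" for n
    using assms by (simp add: monomial_vectors_def)
  have "bij_betw (inv_into (exponents N n) ?s \<circ> vec_index (w n)) {..<r N n} (exponents N n)" for n
    using w by (rule bij_betw_trans) (intro bij_betw_inv_into inj_on_imp_bij_betw inj)
  moreover have "e n = inv_into (exponents N n) ?s \<circ> vec_index (w n)" for n
    by (simp add: e_def fun_eq_iff)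
  ultimately have "bij_betw (e n) {..<r N n} (exponents N n)" for n
    by simp
  moreover have "w n $ l = ?s (e n l)" if "l < r N n" for n l
    unfolding e_def using bij_betwE[OF w[of n]] that by (intro f_inv_into_f[symmetric]) auto
  ultimately show thesis using that by blast
qed

text \<open>A functional that is linear on a subspace with a basis extends linearly to all polynomials.\<close>

lemma linear_functional_extends:
  assumes L: "linear_functional_on V L" and B: "basis_of V B"
  obtains g where "linear g" "\<And>P. P \<in> V \<Longrightarrow> g P = L P"
proof -
  have ind: "Real_Vector_Spaces.independent B" and sp: "Real_Vector_Spaces.span B = V"
    using B by (auto simp: basis_of_def)
  obtain g where g: "linear g" "\<forall>x\<in>B. g x = L x"
    using linear_independent_extend[OF ind, of L] by blast
  have V: "0 \<in> V" "\<And>c x. x \<in> V \<Longrightarrow> c *\<^sub>R x \<in> V" "\<And>x y. x \<in> V \<Longrightarrow> y \<in> V \<Longrightarrow> x + y \<in> V"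
    unfolding sp[symmetric] by (auto intro: span_zero span_scale span_add)
  have "P \<in> V \<and> g P = L P" if "P \<in> Real_Vector_Spaces.span B" for P
    using that
  proof (induction rule: span_induct_alt)
    case base
    have "L (0 *\<^sub>R 0) = 0 * L 0" using L V(1) unfolding linear_functional_on_def by blast
    then show ?case using V(1) linear_0[OF g(1)] by simp
  next
    case (step c x y)
    have "x \<in> V" using step.hyps sp span_base by auto
    then have "L (c *\<^sub>R x + y) = c * L x + L y"
      using L V(2) step.IH by (auto simp: linear_functional_on_def)
    then show ?case
      using V \<open>x \<in> V\<close> step g(2) by (simp add: linear_add[OF g(1)] linear_cmul[OF g(1)])
  qed
  then show thesis using that g(1) sp by blast
qed

lemma (in graded_functional) block_orthogonal_iff:
  assumes w: "\<And>n. dim_vec (w n) = r N n" "\<And>n l. l < r N n \<Longrightarrow> w n $ l = wmon n l"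
    and q: "\<And>n. q n \<in> poly_vec N (r N n)" "\<And>n a. q n $ a = p n a"
  shows "block_orthogonal N w L q \<longleftrightarrow> (\<forall>n. deg_bound n \<and> orth n \<and> pairing n)"
proof -
  have dq: "dim_vec (q n) = r N n" for n using q(1)[of n] by (simp add: poly_vec_def)
  have deg: "deg_bound n \<longleftrightarrow> (\<forall>a<r N n. \<forall>\<alpha>\<in>Poly_Mapping.keys (q n $ a). tdeg \<alpha> \<le> n)" for n
    using p_Sym by (auto simp: deg_bound_def Sym_less_def less_Suc_eq_le q)
  have gram: "gram L (w m) (q n) = mat (r N m) (r N n) (\<lambda>(l, a). L (wmon m l * p n a))" for m n
    by (intro eq_matI) (auto simp: gram_def w dq q)
  have orth: "orth n \<longleftrightarrow> (\<forall>m<n. gram L (w m) (q n) = 0\<^sub>m (r N m) (r N n))" for n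
    unfolding gram orth_def mat_eq_iff by auto
  have pair: "pairing n \<longleftrightarrow> invertible_mat (gram L (w n) (q n))" for n
    unfolding gram pairing_def invertible_mat_iff_nondeg[OF mat_carrier]
    by (rule nondeg_cong) simp
  show ?thesis unfolding block_orthogonal_def deg orth pair using q(1) by blast
qed

theorem theorem3p7:
  fixes N :: "nat \<Rightarrow> nat"
    and w p :: "nat \<Rightarrow> sympoly vec"
  assumes w: "monomial_vectors N w"
    and p: "\<And>n. p n \<in> poly_vec N (r N n)"
    and p0: "p 0 = vec 1 (\<lambda>_. 1)"
  shows
    "(\<exists>L. linear_functional_on (Sym N) L \<and> quasi_definite N L \<and>
          block_orthogonal N w L p \<and> entries_basis N p)
     \<longleftrightarrow>
     (\<exists>M :: int \<Rightarrow> nat \<Rightarrow> nat \<Rightarrow> nat \<Rightarrow> real mat.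
        (\<forall>n. \<forall>m\<in>{1..n}. \<forall>i\<in>{1..N m}. \<forall>k\<in>{- int m..int m}.
           M k n m i \<in> carrier_mat (r N (n - m)) (r_int N (int n - int m + k))) \<and>
        (\<forall>n. \<forall>m\<in>{1..n}. \<forall>i\<in>{1..N m}. \<forall>a<r N (n - m).
           indet m i * p (n - m) $ a =
             (\<Sum>k\<in>{- int m..int m}. mat_poly_vec (M k n m i) (p_int p (int n - int m + k)) $ a)) \<and>
        (let A = (\<lambda>n m i. M (int m) n m i);
             C = (\<lambda>n m i. M (- int m) (n + m) m i)
         in \<forall>n\<ge>1.
              (\<forall>m\<in>{1..n}. \<forall>i\<in>{1..N m}.
                 mrank (A n m i) = r N (n - m) \<and> mrank (C n m i) = r N (n - m)) \<and>
              mrank (stack N (r N n) n (A n)) = r N n \<and>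
              mrank (stack N (r N n) n (\<lambda>m i. transpose_mat (C n m i))) = r N n))"
    (is "?One \<longleftrightarrow> (\<exists>M. ?car M \<and> ?rec M \<and> ?rank M)")
proof -
  obtain e where e: "\<And>n. bij_betw (e n) {..<r N n} (exponents N n)"
    and we: "\<And>n l. l < r N n \<Longrightarrow> w n $ l = Poly_Mapping.single (e n l) 1"
    using monomial_vectors_enumeration[OF w] by blast
  have dim_w: "dim_vec (w n) = r N n" for n using w by (auto simp: monomial_vectors_def)
  have dim_p: "dim_vec (p n) = r N n" for n using p[of n] by (simp add: poly_vec_def)
  let ?p = "\<lambda>n a. p n $ a"
  interpret graded_family N e ?p
    using e p by unfold_locales (auto simp: poly_vec_def)
  show ?thesis
  proof
    assume ?One
    then obtain L where L: "linear_functional_on (Sym N) L" and bo: "block_orthogonal N w L p"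
      and eb: "entries_basis N p" by blast
    obtain B where "basis_of (Sym N) B" using eb by (auto simp: entries_basis_def Let_def)
    then obtain g where g: "linear g" "\<And>P. P \<in> Sym N \<Longrightarrow> g P = L P"
      using linear_functional_extends[OF L] by blast
    interpret graded_functional N e ?p g
      by (intro graded_functional.intro graded_family_axioms graded_functional_axioms.intro g(1))
    have "gram g (w m) (p n) = gram L (w m) (p n)" for m n
    proof (rule eq_matI)
      fix l a assume "l < dim_row (gram L (w m) (p n))" "a < dim_col (gram L (w m) (p n))"
      then have l: "l < r N m" and a: "a < r N n" by (auto simp: gram_def dim_w dim_p)
      have "w m $ l * p n $ a \<in> Sym N"
      proof -
        obtain k where "p n $ a \<in> Sym_less N k" using Sym_in_Sym_less[OF p_Sym[OF a]] .
        then have "w m $ l * p n $ a \<in> Sym_less N (m + k)"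
          unfolding we[OF l] by (rule monomial_mult_Sym_less[OF e_exponents[OF l]])
        then show ?thesis using Sym_less_subset by blast
      qed
      then show "gram g (w m) (p n) $$ (l, a) = gram L (w m) (p n) $$ (l, a)"
        using l a g(2) by (simp add: gram_def dim_w dim_p)
    qed (auto simp: gram_def)
    then have "block_orthogonal N w g p" using bo by (simp add: block_orthogonal_def)
    then have "\<And>n. deg_bound n \<and> orth n \<and> pairing n"
      using block_orthogonal_iff[OF dim_w we p] by blast
    then have *: "\<And>n. deg_bound n \<and> lead n \<and> orth n \<and> pairing n"
      using lead_of_pairing by blast
    then obtain T where T: "recurrence T" using recurrence_exists by blast
    define M where "M k n m i = mat (r N (n - m)) (r_int N (int n - int m + k))
      (\<lambda>(a, b). T (n - m) m i (nat (int n - int m + k)) a b)" for k n m i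
    interpret matrix_recurrence N e ?p p M T
      by unfold_locales (auto simp: dim_p M_def r_int_def of_nat_diff)
    have "?car M" by (simp add: M_def)
    moreover have "?rec M" using recurrence_iff T by blast
    moreover have "?rank M"
      unfolding Let_def
    proof (intro allI impI)
      fix n :: nat assume n: "1 \<le> n"
      have "mrank (M (int m) n m i) = r N (n - m) \<and> mrank (M (- int m) (n + m) m i) = r N (n - m)"
        if m: "m \<in> {1..n}" "i \<in> {1..N m}" for m i
      proof
        show "mrank (M (int m) n m i) = r N (n - m)" using mrank_A[OF T _ m] * by blast
        have "x b = 0"
          if x: "\<forall>a<r N n. (\<Sum>b<r N (n - m). M (- int m) (n + m) m i $$ (a, b) * x b) = 0"
            and b: "b < r N (n - m)" for x b
        proof (rule columns_C[OF T _ _ m _ b])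
          show "(\<Sum>b<r N (n - m). T n m i (n - m) a b * x b) = 0" if "a < r N n" for a
            using x[rule_format, OF that] C_entry[OF m that] by simp
        qed (use * in blast)+
        then show "mrank (M (- int m) (n + m) m i) = r N (n - m)"
          unfolding mrank_eq_cols_iff[OF C_carrier[OF m]] by blast
      qed
      moreover have "stack_A T n" "stack_C T n"
        using stack_A_of_lead[OF T _ n] stack_C_of_pairing[OF T _ _ n] * by blast+
      ultimately show "(\<forall>m\<in>{1..n}. \<forall>i\<in>{1..N m}. mrank (M (int m) n m i) = r N (n - m) \<and>
            mrank (M (- int m) (n + m) m i) = r N (n - m)) \<and>
          mrank (stack N (r N n) n (\<lambda>m i. M (int m) n m i)) = r N n \<and>
          mrank (stack N (r N n) n (\<lambda>m i. transpose_mat (M (- int m) (n + m) m i))) = r N n"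
        unfolding mrank_stack_A mrank_stack_C by blast
    qed
    ultimately show "\<exists>M. ?car M \<and> ?rec M \<and> ?rank M" by blast
  next
    assume "\<exists>M. ?car M \<and> ?rec M \<and> ?rank M"
    then obtain M where car: "?car M" and rec: "?rec M" and rank: "?rank M" by blast
    \<comment> \<open>The lower index of \<open>M\<close> is \<open>n + m\<close> in the expansion of \<open>w_{m,i} p_n\<close>, and \<open>k = j - n\<close>.\<close>
    define T where "T n m i j a b = M (int j - int n) (n + m) m i $$ (a, b)" for n m i j a b
    interpret matrix_recurrence N e ?p p M T
    proof
      show "M k n m i \<in> carrier_mat (r N (n - m)) (r_int N (int n - int m + k))"
        if "m \<in> {1..n}" "i \<in> {1..N m}" "k \<in> {- int m..int m}" for m n i k
        using car that by blast
    qed (auto simp: dim_p T_def)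
    have T: "recurrence T" using recurrence_iff rec by blast
    have stacks: "stack_A T n" "stack_C T n" if "1 \<le> n" for n
      using rank that mrank_stack_A[of n] mrank_stack_C[of n] by (auto simp: Let_def)
    have p00: "p 0 $ 0 = 1" by (simp add: p0)
    have e0: "e 0 0 = 0" using e_exponents[of 0 0] by (simp add: exponents_0)
    have "deg_bound 0" by (simp add: deg_bound_def p00 Sym_less_iff lookup_one when_def tdeg_def)
    then have deg: "deg_bound n" for n using deg_bound_of_recurrence T stacks(1) by blast
    have lead: "lead n" for n
    proof (induction n rule: less_induct)
      case (less n)
      have "lead 0" by (simp add: lead_def nondeg_def p00 e0)
      then show ?case using lead_step[OF T deg _ less, of n] by (cases "n = 0") auto
    qed
    let ?J = "SIGMA n:UNIV. {..<r N n}"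
    have inj: "inj_on (\<lambda>(n, a). p n $ a) ?J" and basis: "basis_of (Sym N) ((\<lambda>(n, a). p n $ a) ` ?J)"
      using family_basis deg lead by blast+
    \<comment> \<open>The functional with value \<open>1\<close> at \<open>p_0 = 1\<close> that annihilates the other basis elements.\<close>
    obtain L where L: "linear L"
      and L_p: "\<And>x. x \<in> (\<lambda>(n, a). p n $ a) ` ?J \<Longrightarrow> L x = (if x = 1 then 1 else 0 :: real)"
      using linear_independent_extend[of _ "\<lambda>x. if x = 1 then 1 else 0"] basis
      unfolding basis_of_def by blast
    interpret graded_functional N e ?p L
      by (intro graded_functional.intro graded_family_axioms graded_functional_axioms.intro L)
    have "p 0 $ 0 \<in> (\<lambda>(n, a). p n $ a) ` ?J" by (rule image_eqI[of _ _ "(0, 0)"]) auto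
    then have L1: "L 1 = 1" using L_p p00 by simp
    have L0: "L (p n $ a) = 0" if n: "1 \<le> n" and a: "a < r N n" for n a
    proof -
      have "p n $ a \<noteq> p 0 $ 0" using inj_onD[OF inj, of "(n, a)" "(0, 0)"] n a by auto
      moreover have "p n $ a \<in> (\<lambda>(n, a). p n $ a) ` ?J"
        using a by (intro image_eqI[of _ _ "(n, a)"]) auto
      ultimately show ?thesis using L_p p00 by simp
    qed
    have orth: "orth n" for n using orth_of_recurrence[OF T] L0 by blast
    have pair: "pairing n" for n
    proof (induction n rule: less_induct)
      case (less n)
      have "pairing 0" by (simp add: pairing_def nondeg_def p00 e0 L1)
      then show ?case using pairing_step[OF T orth stacks(2) less, of n] by (cases "n = 0") auto
    qed
    have "linear_functional_on (Sym N) L"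
      by (simp add: linear_functional_on_def linear_add[OF L] linear_cmul[OF L])
    moreover have "quasi_definite N L" using quasi_definite_L deg lead orth pair by blast
    moreover have "block_orthogonal N w L p"
      using block_orthogonal_iff[OF dim_w we p] deg orth pair by blast
    moreover have "entries_basis N p"
      using inj basis by (simp add: entries_basis_def Let_def dim_p)
    ultimately show ?One by blast
  qed
qed

end
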